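(* Let $n\ge 1$, let $f$ be a transcendental meromorphic function in $\mathbb{C}$ and let $g$ be an entire function in $\mathbb{C}^n$. Put $h(z)=f(z_1+z_2+\cdots+z_n)$ for $z=(z_1,\ldots,z_n)\in\mathbb{C}^n$, and $G^g_h(z)=h(g(z),g(z),\ldots,g(z))$ (so $G^g_h(z)=f(ng(z))$). Suppose that for some $i\in\{1,2,\ldots,n\}$ and some polynomials $a(z)\not\equiv 0$, $b(z)$, $c(z)$ in $\mathbb{C}^n$, $$\frac{\partial h(z)}{\partial z_i}=a(z)\,G^g_h(z)+b(z)\,h(z)+c(z) \qquad (z\in\mathbb{C}^n).$$ Then $g$ must be linear.
   Context: A meromorphic function in $\mathbb{C}$ is transcendental if it is not rational. "Linear" for $g$ means $g$ is a polynomial in $z_1,\ldots,z_n$ of degree at most one. *)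

theory Defs
  imports "HOL-Complex_Analysis.Complex_Analysis" "HOL-Computational_Algebra.Polynomial"
begin

inductive cpoly_fun :: "(complex ^ 'n \<Rightarrow> complex) \<Rightarrow> bool" where
  const: "cpoly_fun (\<lambda>z. c)"
| coord: "cpoly_fun (\<lambda>z. z $ j)"
| add: "cpoly_fun p \<Longrightarrow> cpoly_fun q \<Longrightarrow> cpoly_fun (\<lambda>z. p z + q z)"
| mult: "cpoly_fun p \<Longrightarrow> cpoly_fun q \<Longrightarrow> cpoly_fun (\<lambda>z. p z * q z)"

definition entire_n :: "(complex ^ 'n \<Rightarrow> complex) \<Rightarrow> bool" where
  "entire_n g \<longleftrightarrow> (\<forall>z. \<exists>L. (g has_derivative L) (at z) \<and>
                        (\<forall>c v. L (c *s v) = c * L v))"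

definition rational_mero :: "(complex \<Rightarrow> complex) \<Rightarrow> bool" where
  "rational_mero f \<longleftrightarrow> (\<exists>p q. q \<noteq> 0 \<and> (\<forall>\<^sub>\<approx>z. f z = poly p z / poly q z))"

definition transcendental_mero :: "(complex \<Rightarrow> complex) \<Rightarrow> bool" where
  "transcendental_mero f \<longleftrightarrow> f meromorphic_on UNIV \<and> \<not> rational_mero f"

definition linear_n :: "(complex ^ 'n \<Rightarrow> complex) \<Rightarrow> bool" where
  "linear_n g \<longleftrightarrow> (\<exists>c0 (c :: 'n \<Rightarrow> complex). \<forall>z. g z = c0 + (\<Sum>j\<in>UNIV. c j * z $ j))"


end

theory Submission
  imports Defs "HOL-Computational_Algebra.Fundamental_Theorem_Algebra"
begin

text \<open>
  On the complex line through the origin and a generic point $y$, parametrised by the coordinate sum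
  $s$, the equation becomes $f'(s) = a(s) f(G(s)) + b(s) f(s) + c(s)$ with $G$ entire. Once $G$ is
  known to be affine for generic $y$, continuity gives $g(y) = g(0) + g'(0) y$ everywhere.

  Let $G$ be non-affine. If $G(z)$ is a pole of $f$ and $a(z) \neq 0$, then $z$ is a pole, and at
  points with $G'(z) \neq 0$ its order is one less than that of $G(z)$. Suppose $f$ has infinitely
  many poles. For a polynomial $G$ the number of poles in large discs would essentially have to double.
  For a transcendental $G$ only finitely many values are totally ramified up to finitely many
  points, so among the remaining poles one of minimal order has infinitely many simple preimages,
  which are poles of smaller order. The finiteness of totally ramified values comes
  from the maximum principle for a negatively curved metric on the plane with six singular points.

  Hence $f = F / Q$ with $F$ entire and $Q$ a polynomial. By Schottky's theorem the image under $G$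
  of the disc of radius $r$ contains a circle of radius $\rho \geq c r^2$, so the maximum
  modulus $M$ of $F$ satisfies $M(\rho) \leq C \rho^q r^K M(2r)$. On the other hand
  $M(2r) \leq (2r/\rho)^N M(\rho)$ for every $N$ and large $r$, unless $F$ is a polynomial.
\<close>

section \<open>Landau bound for totally ramified values\<close>

text \<open>Pole orders drop backwards because differentiation raises the order of a pole by one. At
  a simple preimage z of a pole w, f(G) has the order of w, whereas f' has one more than the order
  of z and b f + c at most the order of z. At a multiple preimage the order of f(G) is multiplied
  and the comparison fails, which is why values without simple preimages must be controlled. Only
  the finiteness of the set of such values is required, so a generous number of them can be allowed
  and an explicit metric with elementary weights suffices. For a polynomial G the fibres are finite,
  so a descent on pole orders could end in exceptional points; counting replaces it. Non-affineness
  of G yields both the doubling of fibres and, in the growth argument, radii of order r^2 to compare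
  with 2r. The non-rationality of f enters where F is shown not to be a polynomial. Values of f at
  its singularities carry no information, so identities are derived on punctured neighbourhoods and
  extended by continuity.\<close>

lemma second_derivative_at_local_max:
  fixes F F' :: "real \<Rightarrow> real"
  assumes deriv: "\<forall>\<^sub>F x in nhds 0. (F has_real_derivative F' x) (at x)"
    and deriv2: "(F' has_real_derivative D) (at 0)"
    and max: "\<forall>\<^sub>F x in nhds 0. F x \<le> F 0"
  shows "D \<le> 0"
proof (rule ccontr)
  assume "\<not> D \<le> 0"
  hence D: "D > 0" by simp
  obtain d1 where d1: "d1 > 0" "\<And>x. \<bar>x\<bar> < d1 \<Longrightarrow> (F has_real_derivative F' x) (at x)"
    using deriv unfolding eventually_nhds_metric dist_real_def by auto
  obtain d2 where d2: "d2 > 0" "\<And>x. \<bar>x\<bar> < d2 \<Longrightarrow> F x \<le> F 0"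
    using max unfolding eventually_nhds_metric dist_real_def by auto
  have F'0: "F' 0 = 0"
    using DERIV_local_max[OF d1(2)[of 0] d2(1)] d1(1) d2(2) by force
  obtain d3 where d3: "d3 > 0" "\<And>h. 0 < h \<Longrightarrow> h < d3 \<Longrightarrow> F' 0 < F' (0 + h)"
    using DERIV_pos_inc_right[OF deriv2 D] by auto
  define h where "h = min d1 (min d2 d3) / 2"
  have h: "0 < h" "h < d1" "h < d2" "h < d3" using d1 d2 d3 by (auto simp: h_def)
  have "\<exists>z. 0 < z \<and> z < h \<and> F h - F 0 = (h - 0) * F' z"
    by (rule MVT2) (use h d1 in auto)
  then obtain z where z: "0 < z" "z < h" "F h - F 0 = h * F' z" by auto
  have "F' z > 0" using d3(2)[of z] z h F'0 by simp
  hence "F h > F 0" using z h by (metis diff_gt_0_iff_gt mult_pos_pos)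
  with d2(2)[of h] h show False by simp
qed

text \<open>Locally ln |h| is the real part of log h, whose derivative is h'/h. Differentiating half
  the logarithm of |h|^2 avoids the choice of a branch.\<close>

lemma has_real_derivative_ln_cmod:
  assumes "(h has_field_derivative h') (at (z0 + of_real x * e))" "h (z0 + of_real x * e) \<noteq> 0"
  shows "((\<lambda>x. ln (cmod (h (z0 + of_real x * e)))) has_real_derivative
           Re (e * (h' / h (z0 + of_real x * e)))) (at x)"
proof -
  let ?k = "\<lambda>x::real. h (z0 + of_real x * e)"
  have 1: "(?k has_vector_derivative e * h') (at x)"
    by (rule has_vector_derivative_eq_rhs, rule field_vector_diff_chain_at[of "\<lambda>x. z0 + of_real x * e" e x h h', unfolded o_def])
       (auto intro!: derivative_eq_intros assms)
  have re: "((\<lambda>x. Re (?k x)) has_real_derivative Re (e * h')) (at x)"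
    and im: "((\<lambda>x. Im (?k x)) has_real_derivative Im (e * h')) (at x)"
    using 1 unfolding has_vector_derivative_complex_iff by auto
  define u where "u = (\<lambda>x. Re (?k x))"
  define v where "v = (\<lambda>x. Im (?k x))"
  have re: "(u has_real_derivative Re (e * h')) (at x)"
    and im: "(v has_real_derivative Im (e * h')) (at x)"
    using 1 unfolding has_vector_derivative_complex_iff u_def v_def by auto
  have pos: "(u x)\<^sup>2 + (v x)\<^sup>2 > 0"
    using assms(2) by (simp add: complex_eq_iff sum_power2_gt_zero_iff u_def v_def)
  define a where "a = Re (e * h')"
  define b where "b = Im (e * h')"
  have "((\<lambda>x. ln ((u x)\<^sup>2 + (v x)\<^sup>2) / 2) has_real_derivative
       ((u x * a + v x * b) / ((u x)\<^sup>2 + (v x)\<^sup>2))) (at x)"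
  proof -
    have sq: "((\<lambda>x. (u x)\<^sup>2 + (v x)\<^sup>2) has_real_derivative 2 * (u x * a + v x * b)) (at x)"
      by (auto intro!: derivative_eq_intros re[folded a_def] im[folded b_def])
    have eq: "1 / q * (2 * p) / 2 = p / q" for p q :: real by simp
    from DERIV_cdivide[OF DERIV_chain2[OF DERIV_ln_divide[OF pos] sq], of 2]
    show ?thesis by (rule DERIV_cong) (rule eq)
  qed
  also have "(u x * a + v x * b) / ((u x)\<^sup>2 + (v x)\<^sup>2) = Re (e * h' / ?k x)"
    by (simp add: Re_divide u_def v_def a_def b_def add_divide_distrib mult.commute del: times_complex.sel)
  also have "(\<lambda>x. ln ((u x)\<^sup>2 + (v x)\<^sup>2) / 2) = (\<lambda>x. ln (cmod (?k x)))"
    by (auto simp: cmod_def ln_sqrt u_def v_def)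
  finally show ?thesis by (simp del: times_complex.sel)
qed

lemma has_real_derivative_Re_along_line:
  assumes "(h has_field_derivative h') (at (z0 + of_real x * e))"
  shows "((\<lambda>x. Re (e * h (z0 + of_real x * e))) has_real_derivative Re (e\<^sup>2 * h')) (at x)"
proof -
  have "((\<lambda>x::real. h (z0 + of_real x * e)) has_vector_derivative e * h') (at x)"
    by (rule has_vector_derivative_eq_rhs, rule field_vector_diff_chain_at[of "\<lambda>x. z0 + of_real x * e" e x h h', unfolded o_def])
       (auto intro!: derivative_eq_intros assms)
  hence "((\<lambda>x::real. e * h (z0 + of_real x * e)) has_vector_derivative e * (e * h')) (at x)"
    by (intro has_vector_derivative_mult_right)
  thus ?thesis unfolding has_vector_derivative_complex_iff
    by (simp add: power2_eq_square mult.assoc del: times_complex.sel)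
qed

text \<open>\<open>\<Phi>\<close> is the logarithm of (R^2 - |z|^2)^8 times the eighth power of the
  pulled-back density. Keeping a general direction \<open>e\<close> lets one computation serve for
  both 1 and i, from which the Laplacian is assembled.\<close>

lemma directional_second_derivative_le_0:
  fixes G :: "complex \<Rightarrow> complex" and W :: "complex set" and R :: real and e z0 :: complex
  defines "\<Phi> \<equiv> (\<lambda>z. 8 * ln (R\<^sup>2 - (cmod z)\<^sup>2) + 8 * ln (cmod (deriv G z))
              + (\<Sum>v\<in>W. ln (1 + cmod (G z - v)) - 3 * ln (cmod (G z - v))))"
  defines "b \<equiv> Re (cnj z0 * e)"
  assumes W: "finite W" and S: "open S" "z0 \<in> S" "G holomorphic_on S" "S \<subseteq> ball 0 R"
    and nz: "\<And>z. z \<in> S \<Longrightarrow> G z \<notin> W" "\<And>z. z \<in> S \<Longrightarrow> deriv G z \<noteq> 0"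
    and max: "\<And>z. z \<in> S \<Longrightarrow> \<Phi> z \<le> \<Phi> z0"
    and e: "cmod e = 1"
  shows "8 * (- 2 / (R\<^sup>2 - (cmod z0)\<^sup>2) - 4 * b\<^sup>2 / (R\<^sup>2 - (cmod z0)\<^sup>2)\<^sup>2)
     + 8 * Re (e\<^sup>2 * deriv (\<lambda>z. deriv (deriv G) z / deriv G z) z0)
     + (\<Sum>v\<in>W. cmod (G z0 - v) / (1 + cmod (G z0 - v))\<^sup>2 * (Re (e * (deriv G z0 / (G z0 - v))))\<^sup>2
          + (cmod (G z0 - v) / (1 + cmod (G z0 - v)) - 3) *
            Re (e\<^sup>2 * deriv (\<lambda>z. deriv G z / (G z - v)) z0)) \<le> 0" (is "?D \<le> 0")
proof -
  define A where "A = R\<^sup>2 - (cmod z0)\<^sup>2"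
  have norm_line: "R\<^sup>2 - (cmod (z0 + of_real x * e))\<^sup>2 = A - 2 * x * b - x\<^sup>2" for x
  proof -
    have "(cmod (z0 + of_real x * e))\<^sup>2 = (cmod z0)\<^sup>2 + 2 * x * b + x\<^sup>2 * (cmod e)\<^sup>2"
      unfolding cmod_power2 b_def by (simp add: power2_eq_square algebra_simps)
    thus ?thesis using e by (simp add: A_def)
  qed
  have ev: "\<forall>\<^sub>F x in nhds (0::real). z0 + of_real x * e \<in> S"
  proof -
    have "isCont (\<lambda>x::real. z0 + of_real x * e) 0" by (intro continuous_intros)
    hence "((\<lambda>x::real. z0 + of_real x * e) \<longlongrightarrow> z0) (nhds 0)"
      by (simp add: continuous_at tendsto_nhds_iff)
    thus ?thesis using S(1,2) by (rule topological_tendstoD)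
  qed
  have pos: "A - 2 * x * b - x\<^sup>2 > 0" if "z0 + of_real x * e \<in> S" for x
  proof -
    have "cmod (z0 + of_real x * e) < R" using that S(4) by auto
    hence "(cmod (z0 + of_real x * e))\<^sup>2 < R\<^sup>2" by (intro power_strict_mono) auto
    thus ?thesis using norm_line[of x] by simp
  qed
  have dG: "(G has_field_derivative deriv G z) (at z)" if "z \<in> S" for z
    using holomorphic_derivI[OF S(3,1) that] .
  have hol': "deriv G holomorphic_on S" using S(1,3) by (intro holomorphic_intros)
  have ddG: "(deriv G has_field_derivative deriv (deriv G) z) (at z)" if "z \<in> S" for z
    using hol' S(1) that by (intro holomorphic_derivI)
  define q0 where "q0 = (\<lambda>z. deriv (deriv G) z / deriv G z)"
  define q where "q = (\<lambda>v z. deriv G z / (G z - v))"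
  \<comment> \<open>With |G - v| written as exp of \<open>L\<close>, each summand of
    \<open>\<Phi>\<close> becomes a smooth function of the single quantity \<open>L\<close>, whose
    derivative is known.\<close>
  define L where "L = (\<lambda>v x. ln (cmod (G (z0 + of_real x * e) - v)))"
  have hol_q0: "q0 holomorphic_on S" unfolding q0_def
    using S nz by (intro holomorphic_intros) auto
  have hol_q: "q v holomorphic_on S" if "v \<in> W" for v unfolding q_def
    using S nz that by (intro holomorphic_intros) auto
  have nzv: "G z - v \<noteq> 0" if "z \<in> S" "v \<in> W" for z v using nz(1)[OF that(1)] that(2) by auto
  have expL: "exp (L v x) = cmod (G (z0 + of_real x * e) - v)"
    if "z0 + of_real x * e \<in> S" "v \<in> W" for v x
    using nzv[OF that] by (simp add: L_def)
  define F where "F = (\<lambda>x::real. 8 * ln (A - 2 * x * b - x\<^sup>2)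
      + 8 * ln (cmod (deriv G (z0 + of_real x * e)))
      + (\<Sum>v\<in>W. ln (1 + exp (L v x)) - 3 * L v x))"
  define F' where "F' = (\<lambda>x::real. 8 * ((- 2 * b - 2 * x) / (A - 2 * x * b - x\<^sup>2))
      + 8 * Re (e * q0 (z0 + of_real x * e))
      + (\<Sum>v\<in>W. (exp (L v x) / (1 + exp (L v x)) - 3) * Re (e * q v (z0 + of_real x * e))))"
  have F_eq: "F x = \<Phi> (z0 + of_real x * e)" if "z0 + of_real x * e \<in> S" for x
    unfolding F_def \<Phi>_def norm_line using expL[OF that] by (auto intro!: sum.cong simp: L_def)
  have derivL: "(L v has_real_derivative Re (e * q v (z0 + of_real x * e))) (at x)"
    if "z0 + of_real x * e \<in> S" "v \<in> W" for v x
    unfolding L_def q_def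
    by (rule has_real_derivative_ln_cmod[where h = "\<lambda>z. G z - v" for v])
       (use nzv[OF that] dG[OF that(1)] in \<open>auto intro!: derivative_eq_intros\<close>)
  have one_exp: "1 + exp t \<noteq> 0" "1 + exp t > 0" for t :: real
    by (smt (verit) exp_gt_zero)+
  have dF: "(F has_real_derivative F' x) (at x)" if "z0 + of_real x * e \<in> S" for x
  proof -
    have "((\<lambda>x. ln (A - 2 * x * b - x\<^sup>2)) has_real_derivative
              (- 2 * b - 2 * x) / (A - 2 * x * b - x\<^sup>2)) (at x)"
      using pos[OF that] by (auto intro!: derivative_eq_intros)
    moreover have "((\<lambda>x. ln (cmod (deriv G (z0 + of_real x * e)))) has_real_derivative
              Re (e * q0 (z0 + of_real x * e))) (at x)"
      unfolding q0_def by (rule has_real_derivative_ln_cmod) (use ddG nz that in auto)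
    moreover have "((\<lambda>x. ln (1 + exp (L v x)) - 3 * L v x) has_real_derivative
        (exp (L v x) / (1 + exp (L v x)) - 3) * Re (e * q v (z0 + of_real x * e))) (at x)" if "v \<in> W" for v
      using one_exp
      by (auto intro!: derivative_eq_intros derivL[OF \<open>z0 + of_real x * e \<in> S\<close> that] simp del: times_complex.sel)
         (simp add: field_simps del: times_complex.sel)?
    ultimately show ?thesis unfolding F_def F'_def
      by (intro DERIV_add DERIV_sum DERIV_cmult)
  qed
  have "(F' has_real_derivative ?D) (at 0)"
  proof -
    have A: "A > 0" using pos[of 0] S(2) by simp
    have z0: "z0 + of_real 0 * e \<in> S" using S(2) by simp
    have "((\<lambda>x. (- 2 * b - 2 * x) / (A - 2 * x * b - x\<^sup>2)) has_real_derivative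
        (- 2 / A - 4 * b\<^sup>2 / A\<^sup>2)) (at 0)"
      using A by (auto intro!: derivative_eq_intros simp: field_simps power2_eq_square)
    moreover have "((\<lambda>x. Re (e * q0 (z0 + of_real x * e))) has_real_derivative Re (e\<^sup>2 * deriv q0 z0)) (at 0)"
      by (rule has_real_derivative_Re_along_line) (use holomorphic_derivI[OF hol_q0 S(1,2)] in simp)
    moreover have "((\<lambda>x. (exp (L v x) / (1 + exp (L v x)) - 3) * Re (e * q v (z0 + of_real x * e)))
        has_real_derivative 
         (exp (L v 0) / (1 + exp (L v 0))\<^sup>2 * (Re (e * q v z0))\<^sup>2 
           + (exp (L v 0) / (1 + exp (L v 0)) - 3) * Re (e\<^sup>2 * deriv (q v) z0))) (at 0)" if v: "v \<in> W" for v
    proof -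
      have 1: "((\<lambda>x. Re (e * q v (z0 + of_real x * e))) has_real_derivative Re (e\<^sup>2 * deriv (q v) z0)) (at 0)"
        by (rule has_real_derivative_Re_along_line) (use holomorphic_derivI[OF hol_q[OF v] S(1,2)] in simp)
      have 2: "((\<lambda>x. exp (L v x) / (1 + exp (L v x)) - 3) has_real_derivative
                 exp (L v 0) / (1 + exp (L v 0))\<^sup>2 * Re (e * q v z0)) (at 0)"
        using one_exp derivL[OF z0 v]
        by (auto intro!: derivative_eq_intros simp: power2_eq_square field_simps simp del: times_complex.sel)
      show ?thesis
        by (rule DERIV_cong[OF DERIV_mult[OF 2 1]])
           (simp add: power2_eq_square algebra_simps del: times_complex.sel)
    qed
    ultimately have "(F' has_real_derivative 8 * (- 2 / A - 4 * b\<^sup>2 / A\<^sup>2) + 8 * Re (e\<^sup>2 * deriv q0 z0)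
       + (\<Sum>v\<in>W. (exp (L v 0) / (1 + exp (L v 0))\<^sup>2 * (Re (e * q v z0))\<^sup>2 
           + (exp (L v 0) / (1 + exp (L v 0)) - 3) * Re (e\<^sup>2 * deriv (q v) z0)))) (at 0)"
      unfolding F'_def by (intro DERIV_add DERIV_sum DERIV_cmult)
    also have "(\<Sum>v\<in>W. (exp (L v 0) / (1 + exp (L v 0))\<^sup>2 * (Re (e * q v z0))\<^sup>2 
           + (exp (L v 0) / (1 + exp (L v 0)) - 3) * Re (e\<^sup>2 * deriv (q v) z0))) =
       (\<Sum>v\<in>W. cmod (G z0 - v) / (1 + cmod (G z0 - v))\<^sup>2 * (Re (e * q v z0))\<^sup>2
          + (cmod (G z0 - v) / (1 + cmod (G z0 - v)) - 3) * Re (e\<^sup>2 * deriv (q v) z0))"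
      using expL[OF z0] by (intro sum.cong) auto
    finally show ?thesis unfolding A_def q0_def q_def .
  qed
  moreover have "\<forall>\<^sub>F x in nhds 0. (F has_real_derivative F' x) (at x)"
    using ev by eventually_elim (rule dF)
  moreover have "\<forall>\<^sub>F x in nhds 0. F x \<le> F 0"
    using ev by eventually_elim (use F_eq F_eq[of 0] max S(2) in simp)
  ultimately show ?thesis by (intro second_derivative_at_local_max)
qed

text \<open>Add the inequalities for \<open>e\<close> = 1 and \<open>e\<close> = i: the factor e^2
  changes sign, so the terms with Re (e^2 ...) cancel. What remains is the Laplacian of ln (1 + s),
  namely 1 / (s (1 + s)^2) with s = |w - v|, multiplied by |G'|^2, against the Laplacian of 8 ln
  (R^2 - |z|^2).\<close>

lemma laplacian_at_max:
  fixes G :: "complex \<Rightarrow> complex" and W :: "complex set" and R :: real and z0 :: complex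
  defines "\<Phi> \<equiv> (\<lambda>z. 8 * ln (R\<^sup>2 - (cmod z)\<^sup>2) + 8 * ln (cmod (deriv G z))
              + (\<Sum>v\<in>W. ln (1 + cmod (G z - v)) - 3 * ln (cmod (G z - v))))"
  assumes W: "finite W" and S: "open S" "z0 \<in> S" "G holomorphic_on S" "S \<subseteq> ball 0 R"
    and nz: "\<And>z. z \<in> S \<Longrightarrow> G z \<notin> W" "\<And>z. z \<in> S \<Longrightarrow> deriv G z \<noteq> 0"
    and max: "\<And>z. z \<in> S \<Longrightarrow> \<Phi> z \<le> \<Phi> z0"
  shows "(cmod (deriv G z0))\<^sup>2 * (\<Sum>v\<in>W. 1 / (cmod (G z0 - v) * (1 + cmod (G z0 - v))\<^sup>2))
           \<le> 32 * R\<^sup>2 / (R\<^sup>2 - (cmod z0)\<^sup>2)\<^sup>2"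
proof -
  define A where "A = R\<^sup>2 - (cmod z0)\<^sup>2"
  have A: "A > 0" 
  proof -
    have "cmod z0 < R" using S by auto
    hence "(cmod z0)\<^sup>2 < R\<^sup>2" by (intro power_strict_mono) auto
    thus ?thesis by (simp add: A_def)
  qed
  define s where "s = (\<lambda>v. cmod (G z0 - v))"
  have s: "s v > 0" if "v \<in> W" for v using nz(1)[OF S(2)] that by (auto simp: s_def)
  define q where "q = (\<lambda>v. deriv G z0 / (G z0 - v))"
  define d where "d = (\<lambda>v. deriv (\<lambda>z. deriv G z / (G z - v)) z0)"
  define d0 where "d0 = deriv (\<lambda>z. deriv (deriv G) z / deriv G z) z0"
  define \<tau> where "\<tau> = (\<lambda>v. (s v / (1 + s v) - 3) * Re (d v))"
  have *: "8 * (- 2 / A - 4 * (Re (cnj z0 * e))\<^sup>2 / A\<^sup>2) + 8 * Re (e\<^sup>2 * d0)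
     + (\<Sum>v\<in>W. s v / (1 + s v)\<^sup>2 * (Re (e * q v))\<^sup>2
          + (s v / (1 + s v) - 3) * Re (e\<^sup>2 * d v)) \<le> 0" if "cmod e = 1" for e
    unfolding A_def s_def q_def d_def d0_def
    by (rule directional_second_derivative_le_0[OF W S nz max[unfolded \<Phi>_def] that])
  have 1: "8 * (- 2 / A - 4 * (Re z0)\<^sup>2 / A\<^sup>2) + 8 * Re d0
     + (\<Sum>v\<in>W. s v / (1 + s v)\<^sup>2 * (Re (q v))\<^sup>2 + \<tau> v) \<le> 0"
    using *[of 1] by (simp add: \<tau>_def)
  have 2: "8 * (- 2 / A - 4 * (Im z0)\<^sup>2 / A\<^sup>2) - 8 * Re d0
     + (\<Sum>v\<in>W. s v / (1 + s v)\<^sup>2 * (Im (q v))\<^sup>2 - \<tau> v) \<le> 0"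
    using *[of \<i>] by (simp add: \<tau>_def)
  have "s v / (1 + s v)\<^sup>2 * (Re (q v))\<^sup>2 + s v / (1 + s v)\<^sup>2 * (Im (q v))\<^sup>2 =
      (cmod (deriv G z0))\<^sup>2 * (1 / (s v * (1 + s v)\<^sup>2))" if "v \<in> W" for v
  proof -
    have "s v / (1 + s v)\<^sup>2 * (Re (q v))\<^sup>2 + s v / (1 + s v)\<^sup>2 * (Im (q v))\<^sup>2 = s v / (1 + s v)\<^sup>2 * (cmod (q v))\<^sup>2"
      unfolding cmod_power2 by (simp add: distrib_left)
    also have "cmod (q v) = cmod (deriv G z0) / s v" by (simp add: q_def s_def norm_divide)
    finally show ?thesis using s[OF that] by (simp add: field_simps power2_eq_square)
  qed
  hence eq: "(\<Sum>v\<in>W. s v / (1 + s v)\<^sup>2 * (Re (q v))\<^sup>2 + s v / (1 + s v)\<^sup>2 * (Im (q v))\<^sup>2) =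
      (cmod (deriv G z0))\<^sup>2 * (\<Sum>v\<in>W. 1 / (s v * (1 + s v)\<^sup>2))"
    by (simp add: sum_distrib_left)
  have "(\<Sum>v\<in>W. s v / (1 + s v)\<^sup>2 * (Re (q v))\<^sup>2 + s v / (1 + s v)\<^sup>2 * (Im (q v))\<^sup>2)
        \<le> 32 / A + 32 * (Re z0)\<^sup>2 / A\<^sup>2 + 32 * (Im z0)\<^sup>2 / A\<^sup>2"
    using 1 2 unfolding sum.distrib sum_subtractf by (simp add: right_diff_distrib)
  also have "\<dots> = 32 * (A + (cmod z0)\<^sup>2) / A\<^sup>2"
    unfolding cmod_power2 using A by (simp add: field_simps power2_eq_square)
  also have "A + (cmod z0)\<^sup>2 = R\<^sup>2" by (simp add: A_def)
  finally show ?thesis unfolding eq by (simp only: A_def s_def)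
qed

text \<open>This is the negative upper bound for the curvature: the left side is the eighth power of
  the density, and the sum on the right is the Laplacian of its logarithm. Near a point of
  \<open>W\<close> the two sides grow like s^(-3) and s^(-4). At infinity they decay like |w|^(-2
  card W) and |w|^(-12), which is where six comes from.\<close>

lemma weight_product_bound:
  fixes W :: "complex set"
  assumes W: "finite W" "6 \<le> card W"
  obtains C :: real where "C > 0"
    "\<And>w. w \<notin> W \<Longrightarrow> (\<Prod>v\<in>W. (1 + cmod (w - v)) / cmod (w - v) ^ 3)
            \<le> C * (\<Sum>v\<in>W. 1 / (cmod (w - v) * (1 + cmod (w - v))\<^sup>2)) ^ 4"
proof -
  \<comment> \<open>Half the least distance in \<open>W\<close>: apart from the nearest point
    \<open>j\<close>, every point of \<open>W\<close> has distance at least \<open>\<delta>\<close>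
    from \<open>w\<close>.\<close>
  define \<delta> where "\<delta> = Min ((\<lambda>(u, v). cmod (u - v)) ` (W \<times> W - Id)) / 2"
  have fin: "finite ((\<lambda>(u, v). cmod (u - v)) ` (W \<times> W - Id))" using W by auto
  have "card W \<noteq> 0" "\<not> card W \<le> Suc 0" using W by auto
  then obtain u0 v0 where uv: "u0 \<in> W" "v0 \<in> W" "u0 \<noteq> v0"
    using card_le_Suc0_iff_eq[OF W(1)] by auto
  hence ne: "(\<lambda>(u, v). cmod (u - v)) ` (W \<times> W - Id) \<noteq> {}" by auto
  have \<delta>: "\<delta> > 0" unfolding \<delta>_def using fin ne by (auto simp: Min_gr_iff)
  have sep: "2 * \<delta> \<le> cmod (u - v)" if "u \<in> W" "v \<in> W" "u \<noteq> v" for u v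
    unfolding \<delta>_def using that by (auto intro!: Min_le fin image_eqI[of _ _ "(u, v)"])
  define K where "K = max 1 ((1 + 1 / \<delta>) ^ 3)"
  define C where "C = K ^ card W"
  have K: "K \<ge> 1" by (simp add: K_def)
  show thesis
  proof (rule that[of C])
    show "C > 0" using K by (simp add: C_def)
    fix w assume w: "w \<notin> W"
    define s where "s = (\<lambda>v. cmod (w - v))"
    have s: "s v > 0" if "v \<in> W" for v using w that by (auto simp: s_def)
    obtain j where j: "j \<in> W" "\<And>v. v \<in> W \<Longrightarrow> s j \<le> s v"
      using W(1) uv(1) ex_min_if_finite[of "s ` W"] by (force simp: not_less)
    have far: "\<delta> \<le> s v" if "v \<in> W - {j}" for v
    proof -
      have "2 * \<delta> \<le> cmod (v - j)" using sep j that by auto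
      also have "\<dots> \<le> s v + s j" unfolding s_def
        using norm_triangle_ineq4[of "w - j" "w - v"] by simp
      also have "\<dots> \<le> 2 * s v" using j(2)[of v] that by simp
      finally show ?thesis by simp
    qed
    have factor: "(1 + s v) / s v ^ 3 \<le> K / (1 + s j)\<^sup>2" if v: "v \<in> W - {j}" for v
    proof -
      have sv: "s v > 0" using s v by auto
      have "(1 + s v) / s v = 1 + 1 / s v" using sv by (simp add: field_simps)
      also have "\<dots> \<le> 1 + 1 / \<delta>" using far[OF v] \<delta> sv by (simp add: frac_le)
      finally have "((1 + s v) / s v) ^ 3 \<le> (1 + 1 / \<delta>) ^ 3" using sv by (intro power_mono) auto
      hence a: "((1 + s v) / s v) ^ 3 \<le> K" by (simp add: K_def)
      have "(1 + s v) / s v ^ 3 = ((1 + s v) / s v) ^ 3 / (1 + s v)\<^sup>2"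
        using sv by (simp add: power_divide power2_eq_square power3_eq_cube)
      also have "\<dots> \<le> K / (1 + s j)\<^sup>2"
        using a j(2)[of v] v s[OF j(1)] K by (intro frac_le power_mono) auto
      finally show ?thesis .
    qed
    \<comment> \<open>Five far factors contribute (1 + s)^(-10) with s = \<open>s j\<close>.
      Together with the near factor this is the fourth power of 1 / (s (1 + s)^2) times s / (1 + s),
      and the last quotient is at most 1.\<close>
    have c5: "card (W - {j}) \<ge> 5" using W j by simp
    have "(\<Prod>v\<in>W. (1 + s v) / s v ^ 3) = (1 + s j) / s j ^ 3 * (\<Prod>v\<in>W-{j}. (1 + s v) / s v ^ 3)"
      using W j by (simp add: prod.remove)
    also have "\<dots> \<le> (1 + s j) / s j ^ 3 * (\<Prod>v\<in>W-{j}. K / (1 + s j)\<^sup>2)"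
      using s j factor by (intro mult_left_mono prod_mono) (auto simp: less_imp_le)
    also have "(\<Prod>v\<in>W-{j}. K / (1 + s j)\<^sup>2) = K ^ card (W - {j}) * (1 / (1 + s j)\<^sup>2) ^ card (W - {j})"
      by (simp add: power_divide)
    finally have prod_le: "(\<Prod>v\<in>W. (1 + s v) / s v ^ 3) \<le>
      (1 + s j) / s j ^ 3 * (K ^ card (W - {j}) * (1 / (1 + s j)\<^sup>2) ^ card (W - {j}))" .
    have "K ^ card (W - {j}) * (1 / (1 + s j)\<^sup>2) ^ card (W - {j}) \<le> C * (1 / (1 + s j)\<^sup>2) ^ 5"
      unfolding C_def using K c5 s[OF j(1)] W
      by (intro mult_mono power_increasing power_decreasing card_mono) (auto simp: divide_le_eq_1)
    hence "(1 + s j) / s j ^ 3 * (K ^ card (W - {j}) * (1 / (1 + s j)\<^sup>2) ^ card (W - {j}))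
       \<le> (1 + s j) / s j ^ 3 * (C * (1 / (1 + s j)\<^sup>2) ^ 5)"
      using s[OF j(1)] by (intro mult_left_mono) auto
    with prod_le have "(\<Prod>v\<in>W. (1 + s v) / s v ^ 3) \<le> (1 + s j) / s j ^ 3 * (C * (1 / (1 + s j)\<^sup>2) ^ 5)"
      by (rule order_trans)
    also have "(1 + s j) / s j ^ 3 * (C * (1 / (1 + s j)\<^sup>2) ^ 5) = C * ((1 + s j) / s j ^ 3 * (1 / (1 + s j) ^ 10))"
      by (simp add: power_divide flip: power_mult)
    also have "\<dots> \<le> C * (1 / (s j * (1 + s j)\<^sup>2)) ^ 4"
    proof (rule mult_left_mono)
      have "(1 + s j) / s j ^ 3 * (1 / (1 + s j) ^ 10) = s j / (s j * (1 + s j) ^ 2) ^ 4 * (1 / (1 + s j))"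
        using s[OF j(1)] by (simp add: power_mult_distrib flip: power_mult) (simp add: divide_simps, simp add: eval_nat_numeral)
      also have "\<dots> = (1 / (s j * (1 + s j)\<^sup>2)) ^ 4 * (s j / (1 + s j))"
        by (simp add: power_divide)
      also have "\<dots> \<le> (1 / (s j * (1 + s j)\<^sup>2)) ^ 4 * 1"
        using s[OF j(1)] by (intro mult_left_mono) auto
      finally show "(1 + s j) / s j ^ 3 * (1 / (1 + s j) ^ 10) \<le> (1 / (s j * (1 + s j)\<^sup>2)) ^ 4" by simp
    qed (use \<open>C > 0\<close> in simp)
    also have "\<dots> \<le> C * (\<Sum>v\<in>W. 1 / (s v * (1 + s v)\<^sup>2)) ^ 4"
      using W j s \<open>C > 0\<close>
      by (intro mult_left_mono power_mono member_le_sum) (auto simp: less_imp_le)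
    finally show "(\<Prod>v\<in>W. (1 + cmod (w - v)) / cmod (w - v) ^ 3)
            \<le> C * (\<Sum>v\<in>W. 1 / (cmod (w - v) * (1 + cmod (w - v))\<^sup>2)) ^ 4"
      unfolding s_def .
  qed
qed

text \<open>At a point of multiplicity n >= 2, G' is of order n - 1 and 2 (n - 1) >= n. The estimate
  lets powers of G' absorb the singularity of the metric at \<open>v\<close>.\<close>

lemma deriv_squared_le_near_multiple_point:
  assumes hol: "G holomorphic_on S" "open S" "z0 \<in> S"
    and v: "G z0 = v" "deriv G z0 = 0"
  obtains K r where "K > 0" "r > 0" "ball z0 r \<subseteq> S"
     "\<And>z. z \<in> ball z0 r \<Longrightarrow> (cmod (deriv G z))\<^sup>2 \<le> K * cmod (G z - v)"
proof -
  obtain r0 where r0: "r0 > 0" "ball z0 r0 \<subseteq> S" using hol openE by blast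
  show thesis
  proof (cases "(\<lambda>z. G z - v) constant_on ball z0 r0")
    case True
    then obtain c where c: "\<And>z. z \<in> ball z0 r0 \<Longrightarrow> G z = c"
      unfolding constant_on_def by (metis diff_add_cancel)
    have "deriv G z = 0" if "z \<in> ball z0 r0" for z
    proof -
      have "deriv G z = deriv (\<lambda>_. c) z"
        using eventually_nhds_in_open[OF open_ball that] c
        by (intro deriv_cong_ev) (auto elim: eventually_mono)
      thus ?thesis by simp
    qed
    with r0 that[of 1 r0] show thesis by simp
  next
    case False
    have hol': "(\<lambda>z. G z - v) holomorphic_on ball z0 r0"
      using hol r0 by (intro holomorphic_intros) (auto intro: holomorphic_on_subset)
    obtain g r n where f: "0 < n" "0 < r" "ball z0 r \<subseteq> ball z0 r0" "g holomorphic_on ball z0 r"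
            "\<And>w. w \<in> ball z0 r \<Longrightarrow> G w - v = (w - z0)^n * g w"
            "\<And>w. w \<in> ball z0 r \<Longrightarrow> g w \<noteq> 0"
      by (rule holomorphic_factor_zero_nonconstant[OF hol' open_ball connected_ball _ _ False, of z0])
         (use v r0 in auto)
    have der: "deriv G z = of_nat n * (z - z0) ^ (n - 1) * g z + (z - z0) ^ n * deriv g z"
      if z: "z \<in> ball z0 r" for z
    proof -
      have "deriv G z = deriv (\<lambda>w. v + (w - z0)^n * g w) z"
        using eventually_nhds_in_open[OF open_ball z] f(5)
        by (intro deriv_cong_ev) (auto elim!: eventually_mono simp: algebra_simps)
      also have "\<dots> = of_nat n * (z - z0) ^ (n - 1) * g z + (z - z0) ^ n * deriv g z"
        by (rule DERIV_imp_deriv)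
           (use holomorphic_derivI[OF f(4) open_ball z] in \<open>auto intro!: derivative_eq_intros\<close>)
      finally show ?thesis .
    qed
    have "n \<noteq> 1"
    proof
      assume "n = 1"
      with der[of z0] f(2) f(6)[of z0] v show False by simp
    qed
    with f(1) have n: "n \<ge> 2" by simp
    define \<rho> where "\<rho> = min (r / 2) 1"
    have \<rho>: "\<rho> > 0" "cball z0 \<rho> \<subseteq> ball z0 r" "\<rho> \<le> 1" "\<rho> < r" using f(2) by (auto simp: \<rho>_def)
    \<comment> \<open>\<open>k\<close> is |G'|^2 divided by |z - z0|^(2(n-1)) |g|, continuous on the
      compact disc and hence bounded. The condition \<open>\<rho>\<close> <= 1 permits lowering the
      exponent 2 (n - 1) to n.\<close>
    define k where "k = (\<lambda>z. cmod (of_nat n * g z + (z - z0) * deriv g z) ^ 2 / cmod (g z))"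
    have "deriv g holomorphic_on ball z0 r" using f(4) by (intro holomorphic_intros) auto
    hence "continuous_on (cball z0 \<rho>) k" unfolding k_def
      using \<rho> f(4,6) by (intro continuous_intros) (auto intro!: holomorphic_on_imp_continuous_on intro: holomorphic_on_subset)
    then obtain zm where zm: "\<And>z. z \<in> cball z0 \<rho> \<Longrightarrow> k z \<le> k zm"
      using continuous_attains_sup[of "cball z0 \<rho>" k] \<rho> by force
    show thesis
    proof (rule that[of "1 + k zm" \<rho>])
      have "k zm \<ge> 0" by (simp add: k_def)
      thus "1 + k zm > 0" by simp
      show "ball z0 \<rho> \<subseteq> S" using \<rho> f r0 by force
      fix z assume z: "z \<in> ball z0 \<rho>"
      hence zr: "z \<in> ball z0 r" "z \<in> cball z0 \<rho>" "cmod (z - z0) \<le> 1"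
        using \<rho> by (auto simp: dist_norm norm_minus_commute)
      have "deriv G z = (z - z0) ^ (n - 1) * (of_nat n * g z + (z - z0) * deriv g z)"
        unfolding der[OF zr(1)] using n by (cases n) (auto simp: algebra_simps)
      hence "(cmod (deriv G z))\<^sup>2 = cmod (z - z0) ^ (2 * (n - 1)) * (k z * cmod (g z))"
        using f(6)[OF zr(1)] by (simp add: k_def norm_mult norm_power power_mult_distrib mult.commute flip: power_mult)
      also have "\<dots> \<le> cmod (z - z0) ^ n * ((1 + k zm) * cmod (g z))"
        using zr(3) n zm[OF zr(2)] \<open>k zm \<ge> 0\<close>
        by (intro mult_mono power_decreasing mult_right_mono) (auto simp: k_def)
      also have "\<dots> = (1 + k zm) * cmod (G z - v)"
        using f(5)[OF zr(1)] by (simp add: norm_mult norm_power)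
      finally show "(cmod (deriv G z))\<^sup>2 \<le> (1 + k zm) * cmod (G z - v)" .
    qed (use \<rho> in auto)
  qed
qed

text \<open>
  The left-hand side is the eighth power of the density of the metric
  $\prod_v (1+|w-v|)^{1/8} |w-v|^{-3/8} |dw|$ pulled back by $G$. It vanishes where $G$ takes a value
  $v \in W$ with multiplicity $m \geq 2$, because $8(m-1) > 3m$, so its maximum is attained where
  its logarithm is smooth. Six values are enough for the curvature bound to persist at infinity.
\<close>

lemma ramified_Landau_centered:
  fixes W :: "complex set"
  assumes W: "finite W" "6 \<le> card W"
  obtains C :: real where "C > 0"
    "\<And>G D R. R > 0 \<Longrightarrow> open D \<Longrightarrow> cball 0 R \<subseteq> D \<Longrightarrow> G holomorphic_on D \<Longrightarrow>
       (\<And>z. z \<in> D \<Longrightarrow> G z \<in> W \<Longrightarrow> deriv G z = 0) \<Longrightarrow>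
       cmod (deriv G 0) ^ 8 * (\<Prod>v\<in>W. (1 + cmod (G 0 - v)) / cmod (G 0 - v) ^ 3) \<le> C / R ^ 8"
proof -
  define P where "P = (\<lambda>w. \<Prod>v\<in>W. (1 + cmod (w - v)) / cmod (w - v) ^ 3)"
  define \<Sigma> where "\<Sigma> = (\<lambda>w. \<Sum>v\<in>W. 1 / (cmod (w - v) * (1 + cmod (w - v))\<^sup>2))"
  obtain C where C: "C > 0" "\<And>w. w \<notin> W \<Longrightarrow> P w \<le> C * \<Sigma> w ^ 4"
    using weight_product_bound[OF W] unfolding P_def \<Sigma>_def by blast
  have P_nonneg: "P w \<ge> 0" for w by (auto simp: P_def intro!: prod_nonneg)
  \<comment> \<open>division by zero makes the weight vanish on \<open>W\<close>, which is the correct limit of \<open>V\<close> below\<close>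
  have P_0: "P w = 0" if "w \<in> W" for w using W that by (auto simp: P_def)
  have P_pos: "P w > 0" if "w \<notin> W" for w
    unfolding P_def using that by (intro prod_pos divide_pos_pos zero_less_power add_pos_nonneg) auto
  show thesis
  proof (rule that[of "C * 32 ^ 4"])
    show "C * 32 ^ 4 > 0" using C by simp
    fix G D and R :: real
    assume R: "R > 0" and D: "open D" "cball 0 R \<subseteq> D" and hol: "G holomorphic_on D"
      and ram: "\<And>z. z \<in> D \<Longrightarrow> G z \<in> W \<Longrightarrow> deriv G z = 0"
    have hol': "deriv G holomorphic_on D" using hol D by (intro holomorphic_intros)
    have contG: "isCont G z" "isCont (deriv G) z" if "z \<in> D" for z
      using hol hol' D(1) that by (meson continuous_on_eq_continuous_at holomorphic_on_imp_continuous_on)+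
    \<comment> \<open>The factor with R^2 - |z|^2 vanishes on the boundary circle, so a positive
      maximum of \<open>V\<close> is attained inside the disc.\<close>
    define V where "V = (\<lambda>z. (R\<^sup>2 - (cmod z)\<^sup>2) ^ 8 * (cmod (deriv G z) ^ 8 * P (G z)))"
    have contV: "isCont V z0" if z0: "z0 \<in> D" for z0
    proof (cases "G z0 \<in> W")
      case False
      hence "\<And>v. v \<in> W \<Longrightarrow> cmod (G z0 - v) ^ 3 \<noteq> 0" by auto
      thus ?thesis unfolding V_def P_def using contG[OF z0]
        by (intro continuous_intros) auto
    next
      case True
      define v where "v = G z0"
      have v: "v \<in> W" using True by (simp add: v_def)
      obtain K r where K: "K > 0" "r > 0" "ball z0 r \<subseteq> D"
        "\<And>z. z \<in> ball z0 r \<Longrightarrow> (cmod (deriv G z))\<^sup>2 \<le> K * cmod (G z - v)"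
        using deriv_squared_le_near_multiple_point[OF hol D(1) z0 v_def[symmetric] ram[OF z0 True]] by blast
      define Q where "Q = (\<lambda>w. \<Prod>u\<in>W-{v}. (1 + cmod (w - u)) / cmod (w - u) ^ 3)"
      \<comment> \<open>Six of the eight factors G' cancel |G - v|^(-3); the two left over make this
        majorant of \<open>V\<close> tend to 0 at \<open>z0\<close>.\<close>
      define B where "B = (\<lambda>z. (R\<^sup>2 - (cmod z)\<^sup>2) ^ 8 * (K ^ 3 * (cmod (deriv G z))\<^sup>2 * (1 + cmod (G z - v)) * Q (G z)))"
      have Q_nonneg: "Q w \<ge> 0" for w by (auto simp: Q_def intro!: prod_nonneg)
      have P_eq: "P w = (1 + cmod (w - v)) / cmod (w - v) ^ 3 * Q w" for w
        unfolding P_def Q_def using W v by (simp add: prod.remove)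
      have "isCont B z0" unfolding B_def Q_def v_def using contG[OF z0]
        by (intro continuous_intros) auto
      moreover have "B z0 = 0" using ram[OF z0 True] by (simp add: B_def)
      ultimately have B0: "(B \<longlongrightarrow> 0) (at z0)" by (simp add: isCont_def)
      have "\<forall>\<^sub>F z in at z0. z \<in> ball z0 r" using K(2) by (intro eventually_at_in_open') auto
      hence ev: "\<forall>\<^sub>F z in at z0. V z \<le> B z"
      proof eventually_elim
        case (elim z)
        have "cmod (deriv G z) ^ 8 * ((1 + cmod (G z - v)) / cmod (G z - v) ^ 3)
               \<le> K ^ 3 * (cmod (deriv G z))\<^sup>2 * (1 + cmod (G z - v))"
        proof (cases "G z = v")
          case False
          have "cmod (deriv G z) ^ 8 = ((cmod (deriv G z))\<^sup>2) ^ 3 * (cmod (deriv G z))\<^sup>2"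
            by (simp flip: power_mult power_add)
          also have "\<dots> \<le> (K * cmod (G z - v)) ^ 3 * (cmod (deriv G z))\<^sup>2"
            using K(4)[OF elim] by (intro mult_right_mono power_mono) auto
          finally have "cmod (deriv G z) ^ 8 * ((1 + cmod (G z - v)) / cmod (G z - v) ^ 3) \<le>
            (K * cmod (G z - v)) ^ 3 * (cmod (deriv G z))\<^sup>2 * ((1 + cmod (G z - v)) / cmod (G z - v) ^ 3)"
            by (intro mult_right_mono) auto
          also have "\<dots> = K ^ 3 * (cmod (deriv G z))\<^sup>2 * (1 + cmod (G z - v))"
            using False by (simp add: power_mult_distrib)
          finally show ?thesis .
        qed (use K in simp)
        hence "cmod (deriv G z) ^ 8 * ((1 + cmod (G z - v)) / cmod (G z - v) ^ 3) * Q (G z)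
            \<le> K ^ 3 * (cmod (deriv G z))\<^sup>2 * (1 + cmod (G z - v)) * Q (G z)"
          by (intro mult_right_mono Q_nonneg)
        hence "cmod (deriv G z) ^ 8 * P (G z)
            \<le> K ^ 3 * (cmod (deriv G z))\<^sup>2 * (1 + cmod (G z - v)) * Q (G z)"
          by (simp add: P_eq mult.assoc)
        thus "V z \<le> B z" unfolding V_def B_def by (intro mult_left_mono) auto
      qed
      have "(V \<longlongrightarrow> 0) (at z0)"
        by (rule tendsto_sandwich[OF _ ev _ B0]) (auto simp: V_def P_nonneg intro!: mult_nonneg_nonneg)
      moreover have "V z0 = 0" using P_0[OF True] by (simp add: V_def)
      ultimately show ?thesis by (simp add: isCont_def)
    qed
    have "continuous_on (cball 0 R) V"
      using contV D by (intro continuous_at_imp_continuous_on) auto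
    then obtain zm where zm: "zm \<in> cball 0 R" "\<And>z. z \<in> cball 0 R \<Longrightarrow> V z \<le> V zm"
      using continuous_attains_sup[of "cball 0 R" V] R by force
    have bound: "V zm \<le> C * 32 ^ 4 * R ^ 8"
    proof (cases "V zm > 0")
      case True
      have zmR: "cmod zm < R"
      proof (rule ccontr)
        assume "\<not> cmod zm < R"
        hence "cmod zm = R" using zm(1) by simp
        with True show False by (simp add: V_def)
      qed
      define A where "A = R\<^sup>2 - (cmod zm)\<^sup>2"
      have A_pos: "R\<^sup>2 - (cmod z)\<^sup>2 > 0" if "cmod z < R" for z
        using power_strict_mono[OF that] by simp
      have A: "A > 0" using A_pos[OF zmR] by (simp add: A_def)
      define S where "S = {z \<in> ball 0 R. G z \<notin> W \<and> deriv G z \<noteq> 0}"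
      have SD: "S \<subseteq> D" using D(2) by (auto simp: S_def)
      have zmS: "zm \<in> S" using True zmR P_0[of "G zm"] by (auto simp: S_def V_def)
      have "open S"
      proof -
        have sub: "ball 0 R \<subseteq> D" using D(2) ball_subset_cball by blast
        have "open (ball 0 R \<inter> G -` (- W))"
          using hol sub W by (intro continuous_open_preimage holomorphic_on_imp_continuous_on)
            (auto intro: holomorphic_on_subset simp: finite_imp_closed open_Compl)
        moreover have "open (ball 0 R \<inter> deriv G -` (- {0}))"
          using hol' sub by (intro continuous_open_preimage holomorphic_on_imp_continuous_on)
            (auto intro: holomorphic_on_subset)
        ultimately have "open ((ball 0 R \<inter> G -` (- W)) \<inter> (ball 0 R \<inter> deriv G -` (- {0})))"
          by (rule open_Int)
        also have "\<dots> = S" by (auto simp: S_def)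
        finally show ?thesis .
      qed
      define \<Phi> where "\<Phi> = (\<lambda>z. 8 * ln (R\<^sup>2 - (cmod z)\<^sup>2) + 8 * ln (cmod (deriv G z))
              + (\<Sum>v\<in>W. ln (1 + cmod (G z - v)) - 3 * ln (cmod (G z - v))))"
      have lnV: "V z > 0" "ln (V z) = \<Phi> z" if "z \<in> S" for z
      proof -
        have *: "cmod z < R" "G z \<notin> W" "deriv G z \<noteq> 0" using that by (auto simp: S_def)
        have fac: "(1 + cmod (G z - v)) / cmod (G z - v) ^ 3 > 0" if "v \<in> W" for v
          using that *(2) by (intro divide_pos_pos zero_less_power add_pos_nonneg) auto
        have "ln (P (G z)) = (\<Sum>v\<in>W. ln ((1 + cmod (G z - v)) / cmod (G z - v) ^ 3))"
          unfolding P_def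
        proof (rule ln_prod[OF W(1)])
          show "(1 + cmod (G z - v)) / cmod (G z - v) ^ 3 \<noteq> 0" if "v \<in> W" for v
            using fac[OF that] by linarith
        qed
        also have "\<dots> = (\<Sum>v\<in>W. ln (1 + cmod (G z - v)) - 3 * ln (cmod (G z - v)))"
        proof (intro sum.cong refl)
          fix v assume "v \<in> W"
          hence "cmod (G z - v) > 0" using *(2) by auto
          moreover have "1 + cmod (G z - v) > 0" by (rule add_pos_nonneg) auto
          ultimately show "ln ((1 + cmod (G z - v)) / cmod (G z - v) ^ 3) =
              ln (1 + cmod (G z - v)) - 3 * ln (cmod (G z - v))"
            by (simp add: ln_div ln_realpow)
        qed
        finally show "ln (V z) = \<Phi> z"
          unfolding V_def \<Phi>_def using A_pos[OF *(1)] P_pos[OF *(2)] *(3)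
          by (simp add: ln_mult ln_realpow)
        show "V z > 0" unfolding V_def using A_pos[OF *(1)] P_pos[OF *(2)] *(3) by simp
      qed
      have max: "\<Phi> z \<le> \<Phi> zm" if "z \<in> S" for z
        unfolding lnV(2)[OF that, symmetric] lnV(2)[OF zmS, symmetric]
        using lnV(1)[OF that] lnV(1)[OF zmS] zm(2)[of z] that by (subst ln_le_cancel_iff) (auto simp: S_def)
      have lap: "(cmod (deriv G zm))\<^sup>2 * \<Sigma> (G zm) \<le> 32 * R\<^sup>2 / A\<^sup>2"
        unfolding \<Sigma>_def A_def
        by (rule laplacian_at_max[OF W(1) \<open>open S\<close> zmS])
           (use hol SD max in \<open>auto intro: holomorphic_on_subset simp: S_def \<Phi>_def\<close>)
      have "\<Sigma> (G zm) \<ge> 0" by (auto simp: \<Sigma>_def intro!: sum_nonneg)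
      \<comment> \<open>The bound by the fourth power of \<open>\<Sigma>\<close> is homogeneous with
        |G'|^8, so the Laplacian inequality applies to the product and all powers of
        \<open>A\<close> cancel.\<close>
      have "V zm \<le> A ^ 8 * (cmod (deriv G zm) ^ 8 * (C * \<Sigma> (G zm) ^ 4))"
        unfolding V_def A_def[symmetric] using zmS A C(2)[of "G zm"]
        by (intro mult_left_mono) (auto simp: S_def)
      also have "\<dots> = A ^ 8 * C * ((cmod (deriv G zm))\<^sup>2 * \<Sigma> (G zm)) ^ 4"
        by (simp add: power_mult_distrib flip: power_mult)
      also have "\<dots> \<le> A ^ 8 * C * (32 * R\<^sup>2 / A\<^sup>2) ^ 4"
        using lap A C \<open>\<Sigma> (G zm) \<ge> 0\<close> by (intro mult_left_mono power_mono) auto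
      also have "\<dots> = C * 32 ^ 4 * R ^ 8"
        using A by (simp add: power_divide power_mult_distrib flip: power_mult)
      finally show ?thesis .
    next
      case False
      have "C * 32 ^ 4 * R ^ 8 \<ge> 0" using C R by simp
      with False show ?thesis by linarith
    qed
    \<comment> \<open>At the centre the cut-off factor equals R^16, while the maximum is only of
      size R^8; the quotient is the asserted decay.\<close>
    define X where "X = cmod (deriv G 0) ^ 8 * P (G 0)"
    have R16: "R ^ 8 * R ^ 8 = (R\<^sup>2) ^ 8" by (simp flip: power_add power_mult)
    have "R ^ 8 * (R ^ 8 * X) = V 0"
      unfolding mult.assoc[symmetric] R16 by (simp add: V_def X_def)
    also have "\<dots> \<le> C * 32 ^ 4 * R ^ 8" using zm(2)[of 0] bound R by simp
    also have "\<dots> = R ^ 8 * (C * 32 ^ 4)" by (rule mult.commute)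
    finally have "R ^ 8 * X \<le> C * 32 ^ 4"
      by (rule mult_left_le_imp_le) (use R in simp)
    thus "cmod (deriv G 0) ^ 8 * (\<Prod>v\<in>W. (1 + cmod (G 0 - v)) / cmod (G 0 - v) ^ 3) \<le> C * 32 ^ 4 / R ^ 8"
      using R by (simp add: X_def P_def pos_le_divide_eq mult.commute)
  qed
qed

lemma ramified_Landau:
  fixes W :: "complex set" and M :: real
  assumes W: "finite W" "6 \<le> card W"
  obtains C :: real where "C > 0"
    "\<And>G z0 R. R > 0 \<Longrightarrow> G holomorphic_on ball z0 R \<Longrightarrow>
       (\<And>z. z \<in> ball z0 R \<Longrightarrow> G z \<in> W \<Longrightarrow> deriv G z = 0) \<Longrightarrow> cmod (G z0) \<le> M \<Longrightarrow>
       cmod (deriv G z0) \<le> C / R"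
proof -
  obtain C0 where C0: "C0 > 0"
    "\<And>G D R. R > 0 \<Longrightarrow> open D \<Longrightarrow> cball 0 R \<subseteq> D \<Longrightarrow> G holomorphic_on D \<Longrightarrow>
       (\<And>z. z \<in> D \<Longrightarrow> G z \<in> W \<Longrightarrow> deriv G z = 0) \<Longrightarrow>
       cmod (deriv G 0) ^ 8 * (\<Prod>v\<in>W. (1 + cmod (G 0 - v)) / cmod (G 0 - v) ^ 3) \<le> C0 / R ^ 8"
    using ramified_Landau_centered[OF W] by blast
  define N where "N = (\<Prod>v\<in>W. (1 + \<bar>M\<bar> + cmod v)\<^sup>2)"
  have N: "N > 0" unfolding N_def by (intro prod_pos zero_less_power) (auto intro: add_pos_nonneg)
  \<comment> \<open>The factor 2 comes from applying the centred bound on the closed disc of radius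
    R / 2 inside the open ball.\<close>
  define C where "C = 2 * root 8 (C0 * N)"
  show thesis
  proof (rule that[of C])
    show "C > 0" using C0 N by (simp add: C_def)
    fix G z0 and R :: real
    assume R: "R > 0" and hol: "G holomorphic_on ball z0 R"
      and ram: "\<And>z. z \<in> ball z0 R \<Longrightarrow> G z \<in> W \<Longrightarrow> deriv G z = 0" and M: "cmod (G z0) \<le> M"
    show "cmod (deriv G z0) \<le> C / R"
    proof (cases "G z0 \<in> W")
      case True
      thus ?thesis using ram[of z0] R \<open>C > 0\<close> by simp
    next
      case False
      define H where "H = (\<lambda>z. G (z0 + z))"
      have der: "deriv H z = deriv G (z0 + z)" if "z \<in> ball 0 R" for z
      proof -
        have "(G has_field_derivative deriv G (z0 + z)) (at (z0 + z))"
          using that by (intro holomorphic_derivI[OF hol]) (auto simp: dist_norm)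
        hence "(H has_field_derivative deriv G (z0 + z) * 1) (at z)" unfolding H_def
          by (rule DERIV_chain2) (auto intro!: derivative_eq_intros)
        thus ?thesis by (auto intro: DERIV_imp_deriv)
      qed
      have "cmod (deriv H 0) ^ 8 * (\<Prod>v\<in>W. (1 + cmod (H 0 - v)) / cmod (H 0 - v) ^ 3) \<le> C0 / (R / 2) ^ 8"
      proof (rule C0(2)[where D = "ball 0 R"])
        show "H holomorphic_on ball 0 R" unfolding H_def
          by (rule holomorphic_on_compose_gen[of "\<lambda>z. z0 + z" _ G "ball z0 R", unfolded o_def])
             (auto intro!: holomorphic_intros hol simp: dist_norm)
      qed (use R der ram in \<open>auto simp: H_def dist_norm\<close>)
      hence *: "cmod (deriv G z0) ^ 8 * (\<Prod>v\<in>W. (1 + cmod (G z0 - v)) / cmod (G z0 - v) ^ 3) \<le> C0 / (R / 2) ^ 8"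
        using der[of 0] R by (simp add: H_def)
      have "1 / N \<le> (\<Prod>v\<in>W. (1 + cmod (G z0 - v)) / cmod (G z0 - v) ^ 3)"
      proof -
        have "1 / N = (\<Prod>v\<in>W. 1 / (1 + \<bar>M\<bar> + cmod v)\<^sup>2)" by (simp add: N_def prod_dividef)
        also have "\<dots> \<le> (\<Prod>v\<in>W. (1 + cmod (G z0 - v)) / cmod (G z0 - v) ^ 3)"
      proof (intro prod_mono conjI)
        fix v assume v: "v \<in> W"
        define s where "s = cmod (G z0 - v)"
        have s: "s > 0" using False v by (auto simp: s_def)
        have "s \<le> 1 + \<bar>M\<bar> + cmod v" using norm_triangle_ineq4[of "G z0" v] M by (simp add: s_def)
        hence "1 / (1 + \<bar>M\<bar> + cmod v)\<^sup>2 \<le> 1 / s\<^sup>2" using s by (intro frac_le power_mono) auto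
        also have "\<dots> \<le> (1 + s) / s ^ 3" using s by (simp add: field_simps eval_nat_numeral)
        finally show "1 / (1 + \<bar>M\<bar> + cmod v)\<^sup>2 \<le> (1 + cmod (G z0 - v)) / cmod (G z0 - v) ^ 3"
          by (simp add: s_def)
      qed auto
      finally show ?thesis .
      qed
      hence "cmod (deriv G z0) ^ 8 * (1 / N) \<le> C0 / (R / 2) ^ 8"
        by (intro order_trans[OF mult_left_mono *]) auto
      hence "cmod (deriv G z0) ^ 8 \<le> (C0 * N) / (R / 2) ^ 8"
        using N by (simp add: field_simps)
      also have "C0 * N = root 8 (C0 * N) ^ 8" using C0 N by simp
      also have "root 8 (C0 * N) ^ 8 / (R / 2) ^ 8 = (C / R) ^ 8"
        by (simp add: C_def power_divide power_mult_distrib)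
      finally show ?thesis using R \<open>C > 0\<close> power_mono_iff[of "cmod (deriv G z0)" "C / R" 8] by simp
    qed
  qed
qed

text \<open>In the coordinate log z the exterior of the disc of radius \<open>R0\<close> is a
  half-plane and a circle has length 2 pi. The Landau bound at distance \<open>\<rho>\<close> from
  the edge of the half-plane is C / \<open>\<rho>\<close>, so far out \<open>g\<close> varies by
  less than 1 along the circle.\<close>

lemma image_of_large_circle_small:
  fixes W :: "complex set" and M R0 :: real
  assumes g: "g holomorphic_on UNIV" and W: "finite W" "6 \<le> card W" and R0: "R0 > 0"
    and ram: "\<And>z. cmod z > R0 \<Longrightarrow> g z \<in> W \<Longrightarrow> deriv g z = 0"
  obtains R1 where "R1 > 0"
    "\<And>z z'. cmod z \<ge> R1 \<Longrightarrow> cmod z' = cmod z \<Longrightarrow> cmod (g z) \<le> M \<Longrightarrow> cmod (g z') \<le> M + 1"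
proof -
  obtain C where C: "C > 0"
    "\<And>G z0 R. R > 0 \<Longrightarrow> G holomorphic_on ball z0 R \<Longrightarrow>
       (\<And>z. z \<in> ball z0 R \<Longrightarrow> G z \<in> W \<Longrightarrow> deriv G z = 0) \<Longrightarrow> cmod (G z0) \<le> M + 1 \<Longrightarrow>
       cmod (deriv G z0) \<le> C / R"
    using ramified_Landau[OF W, of "M + 1"] by blast
  \<comment> \<open>Chosen so that the distance \<open>\<rho>\<close> to the edge is at least 2 pi C
    + 1 and the variation 2 pi C / \<open>\<rho>\<close> stays below 1.\<close>
  define R1 where "R1 = R0 * exp (2 * pi * C + 1)"
  have R1: "R1 > 0" using R0 by (simp add: R1_def)
  have lnR1: "ln R1 = ln R0 + (2 * pi * C + 1)" using R0 by (simp add: R1_def ln_mult)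
  define G where "G = (\<lambda>\<zeta>. g (exp \<zeta>))"
  have derG: "(G has_field_derivative deriv g (exp \<zeta>) * exp \<zeta>) (at \<zeta>)" for \<zeta>
    unfolding G_def by (rule DERIV_chain2[OF holomorphic_derivI[OF g open_UNIV UNIV_I]]) simp
  have derivG: "deriv G \<zeta> = deriv g (exp \<zeta>) * exp \<zeta>" for \<zeta>
    by (rule DERIV_imp_deriv[OF derG])
  have holG: "G holomorphic_on UNIV"
    unfolding holomorphic_on_def field_differentiable_def using derG has_field_derivative_at_within by blast
  show thesis
  proof (rule that[OF R1], rule ccontr)
    fix z z' assume z: "cmod z \<ge> R1" "cmod z' = cmod z" "cmod (g z) \<le> M" and not: "\<not> cmod (g z') \<le> M + 1"
    have nz: "z \<noteq> 0" "z' \<noteq> 0" using z R1 by auto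
    define \<rho> where "\<rho> = ln (cmod z) - ln R0"
    have "ln R1 \<le> ln (cmod z)" using z R1 nz by (subst ln_le_cancel_iff) auto
    hence \<rho>: "\<rho> \<ge> 2 * pi * C + 1" unfolding \<rho>_def lnR1 by simp
    hence \<rho>_pos: "\<rho> > 0" using C(1) by (smt (verit) mult_pos_pos pi_gt_zero)
    \<comment> \<open>The two logarithms have equal real part, so this segment is vertical and keeps
      its distance from the edge of the half-plane.\<close>
    define \<gamma> where "\<gamma> = (\<lambda>s::real. Ln z + of_real s * (Ln z' - Ln z))"
    have Re_\<gamma>: "Re (\<gamma> s) = ln (cmod z)" for s using nz z(2) by (simp add: \<gamma>_def)
    have len: "cmod (Ln z' - Ln z) \<le> 2 * pi"
    proof -
      have "cmod (Ln z' - Ln z) \<le> \<bar>Re (Ln z' - Ln z)\<bar> + \<bar>Im (Ln z' - Ln z)\<bar>" by (rule cmod_le)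
      also have "Re (Ln z' - Ln z) = 0" using nz z(2) by simp
      also have "\<bar>Im (Ln z' - Ln z)\<bar> \<le> 2 * pi"
        using mpi_less_Im_Ln[OF nz(1)] Im_Ln_le_pi[OF nz(1)] mpi_less_Im_Ln[OF nz(2)] Im_Ln_le_pi[OF nz(2)] by simp
      finally show ?thesis by simp
    qed
    define u where "u = (\<lambda>s. cmod (G (\<gamma> s)))"
    have u0: "u 0 \<le> M" using z(3) nz by (simp add: u_def \<gamma>_def G_def)
    have u1: "u 1 > M + 1" using not nz by (simp add: u_def \<gamma>_def G_def)
    have contu: "continuous_on A u" for A
      unfolding u_def \<gamma>_def
      by (intro continuous_intros continuous_on_compose2[OF holomorphic_on_imp_continuous_on[OF holG]]) auto
    \<comment> \<open>The Landau constant is valid only while |G| <= M + 1. Stopping at the first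
      time this value is reached makes it available on the whole path up to there.\<close>
    define T where "T = {s \<in> {0..1}. u s = M + 1}"
    have "\<exists>s. 0 \<le> s \<and> s \<le> 1 \<and> u s = M + 1"
      using u0 u1 contu by (intro IVT') auto
    hence "T \<noteq> {}" by (auto simp: T_def)
    moreover have "compact T"
    proof -
      have "closed T" unfolding T_def by (intro continuous_closed_preimage_constant contu) auto
      moreover have "bounded T" by (rule bounded_subset[of "{0..1}"]) (auto simp: T_def)
      ultimately show ?thesis by (simp add: compact_eq_bounded_closed)
    qed
    ultimately obtain s1 where s1: "s1 \<in> T" "\<And>s. s \<in> T \<Longrightarrow> s1 \<le> s"
      using compact_attains_inf[of T] by blast
    have s1': "0 \<le> s1" "s1 \<le> 1" "u s1 = M + 1" using s1 by (auto simp: T_def)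
    have u_le: "u s \<le> M + 1" if s: "0 \<le> s" "s \<le> s1" for s
    proof (rule ccontr)
      assume "\<not> u s \<le> M + 1"
      moreover from this have "s \<noteq> s1" using s1' by auto
      ultimately obtain t where "0 \<le> t" "t \<le> s" "u t = M + 1" 
        using IVT'[of u 0 "M + 1" s] u0 contu s by auto
      with s1(2)[of t] s1'(2) s \<open>s \<noteq> s1\<close> show False by (auto simp: T_def)
    qed
    have bound: "cmod (deriv G (\<gamma> s)) \<le> C / \<rho>" if "0 \<le> s" "s \<le> s1" for s
    proof (rule C(2)[OF \<rho>_pos])
      fix w assume w: "w \<in> ball (\<gamma> s) \<rho>" "G w \<in> W"
      have "Re (\<gamma> s) - Re w \<le> cmod (\<gamma> s - w)" using complex_Re_le_cmod[of "\<gamma> s - w"] by simp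
      also have "\<dots> < \<rho>" using w by (simp add: dist_norm)
      finally have "Re w > ln R0" by (simp add: Re_\<gamma> \<rho>_def)
      hence "cmod (exp w) > R0" using R0 by (metis norm_exp_eq_Re exp_less_mono exp_ln)
      from ram[OF this] w(2) show "deriv G w = 0" unfolding derivG by (simp add: G_def)
    qed (use holG u_le[OF that] in \<open>auto intro: holomorphic_on_subset simp: u_def\<close>)
    have "cmod (G (\<gamma> s1) - G (\<gamma> 0)) \<le> C / \<rho> * cmod (\<gamma> s1 - \<gamma> 0)"
    proof (rule field_differentiable_bound[of "closed_segment (\<gamma> 0) (\<gamma> s1)" G "deriv G"])
      fix w assume w: "w \<in> closed_segment (\<gamma> 0) (\<gamma> s1)"
      show "(G has_field_derivative deriv G w) (at w within closed_segment (\<gamma> 0) (\<gamma> s1))"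
        using derG[of w] unfolding derivG by (rule has_field_derivative_at_within)
      from w obtain t where t: "0 \<le> t" "t \<le> 1" "w = (1 - t) *\<^sub>R \<gamma> 0 + t *\<^sub>R \<gamma> s1"
        by (auto simp: closed_segment_def)
      have "w = \<gamma> (t * s1)" unfolding t(3) \<gamma>_def by (simp add: scaleR_conv_of_real algebra_simps)
      moreover have "t * s1 \<le> s1" using t s1' by (simp add: mult_left_le_one_le)
      ultimately show "cmod (deriv G w) \<le> C / \<rho>" using bound[of "t * s1"] t s1' by simp
    qed auto
    also have "\<gamma> s1 - \<gamma> 0 = of_real s1 * (Ln z' - Ln z)" by (simp add: \<gamma>_def)
    also have "cmod \<dots> \<le> 1 * (2 * pi)"
      unfolding norm_mult using s1' len by (intro mult_mono) auto
    finally have "cmod (G (\<gamma> s1) - G (\<gamma> 0)) \<le> C / \<rho> * (2 * pi)"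
      using C(1) \<rho>_pos by (simp add: mult_left_mono divide_right_mono)
    also have "\<dots> < 1" using \<rho> \<rho>_pos by (simp add: field_simps)
    finally have "cmod (G (\<gamma> s1)) < cmod (G (\<gamma> 0)) + 1"
      using norm_triangle_sub[of "G (\<gamma> s1)" "G (\<gamma> 0)"] by linarith
    with u0 s1'(3) show False by (simp add: u_def)
  qed
qed

text \<open>Either g tends to infinity and is a polynomial, or |g| <= M at points of arbitrarily
  large modulus. In the second case |g| <= M + 1 on whole large circles, hence everywhere, and
  Liouville's theorem applies.\<close>

lemma entire_ramified_imp_polynomial:
  fixes W :: "complex set" and R0 :: real
  assumes g: "g holomorphic_on UNIV" and W: "finite W" "6 \<le> card W" and R0: "R0 > 0"
    and ram: "\<And>z. cmod z > R0 \<Longrightarrow> g z \<in> W \<Longrightarrow> deriv g z = 0"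
  shows "\<exists>p. g = poly p"
proof (cases "\<forall>M. \<exists>R. \<forall>z. cmod z \<ge> R \<longrightarrow> cmod (g z) > M")
  case True
  have "filterlim g at_infinity at_infinity"
    unfolding filterlim_at_infinity[OF order_refl] eventually_at_infinity
    using True by (meson less_imp_le)
  hence "((inverse \<circ> g) \<longlongrightarrow> 0) at_infinity"
    unfolding o_def by (rule filterlim_compose[OF tendsto_inverse_0])
  from pole_at_infinity[OF g this] obtain a n where "\<And>z. g z = (\<Sum>i\<le>n. a i * z ^ i)" by blast
  hence "g = poly (\<Sum>i\<le>n. monom (a i) i)" by (auto simp: poly_sum poly_monom)
  thus ?thesis by blast
next
  case False
  then obtain M where M: "\<And>R. \<exists>z. cmod z \<ge> R \<and> cmod (g z) \<le> M" by (force simp: not_less)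
  obtain R1 where R1: "R1 > 0"
    "\<And>z z'. cmod z \<ge> R1 \<Longrightarrow> cmod z' = cmod z \<Longrightarrow> cmod (g z) \<le> M \<Longrightarrow> cmod (g z') \<le> M + 1"
    using image_of_large_circle_small[OF g W R0 ram, of M] by blast
  have "cmod (g w) \<le> M + 1" for w
  proof -
    obtain z where z: "cmod z \<ge> max R1 (cmod w + 1)" "cmod (g z) \<le> M" using M by blast
    show ?thesis
    proof (rule maximum_modulus_frontier[of g "ball 0 (cmod z)"])
      show "cmod (g z') \<le> M + 1" if "z' \<in> frontier (ball 0 (cmod z))" for z'
      proof -
        have "cmod z > 0" using R1(1) z(1) by auto
        hence "cmod z' = cmod z" using that by (simp add: frontier_ball)
        thus ?thesis using R1(2)[of z z'] z by simp
      qed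
    qed (use g z in \<open>auto intro: holomorphic_on_subset holomorphic_on_imp_continuous_on\<close>)
  qed
  hence "bounded (range g)" by (auto intro!: boundedI)
  then obtain c where "\<And>z. g z = c" using Liouville_theorem[OF g] by (auto simp: constant_on_def)
  hence "g = poly [:c:]" by auto
  thus ?thesis by blast
qed

text \<open>Six such values have only finitely many simple preimages altogether, so outside a
  suitable disc all six are totally ramified.\<close>

lemma finite_totally_ramified_values:
  assumes g: "g holomorphic_on UNIV" and not_poly: "\<nexists>p. g = poly p"
  shows "finite {w. finite {z. g z = w \<and> deriv g z \<noteq> 0}}" (is "finite ?A")
proof (rule ccontr)
  assume "infinite ?A"
  then obtain W where W: "finite W" "card W = 6" "W \<subseteq> ?A"
    using infinite_arbitrarily_large by blast
  define U where "U = (\<Union>w\<in>W. {z. g z = w \<and> deriv g z \<noteq> 0})"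
  have "finite U" using W by (auto simp: U_def)
  then obtain R where R: "\<And>z. z \<in> U \<Longrightarrow> cmod z \<le> R"
    by (meson finite_imp_bounded bounded_iff)
  have "deriv g z = 0" if "cmod z > max R 1" "g z \<in> W" for z
  proof (rule ccontr)
    assume "deriv g z \<noteq> 0"
    with that(2) have "cmod z \<le> R" by (intro R) (auto simp: U_def)
    with that(1) show False by simp
  qed
  hence "\<exists>p. g = poly p"
    using W by (intro entire_ramified_imp_polynomial[OF g, of W "max R 1"]) auto
  with not_poly show False by blast
qed

section \<open>Poles\<close>

lemma entire_nonconstant_eventually_neq:
  assumes g: "g holomorphic_on UNIV" and nc: "\<not> g constant_on UNIV"
  shows "\<forall>\<^sub>F z in at z0. g z \<noteq> w"
proof -
  have "\<not> (\<forall>z. g z = w)" using nc by (auto simp: constant_on_def)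
  then obtain z1 where z1: "g z1 \<noteq> w" by blast
  have "(\<lambda>z. g z - w) holomorphic_on UNIV" using g by (intro holomorphic_intros)
  hence "eventually (\<lambda>z. g z - w \<noteq> 0 \<and> z \<in> UNIV) (at z0)"
    using z1 by (intro non_zero_neighbour_alt[of "\<lambda>z. g z - w" UNIV z0 z1]) auto
  thus ?thesis by eventually_elim simp
qed

text \<open>The equation is required only where \<open>f\<close> is analytic at both points, since
  its value at a singularity is arbitrary. Because \<open>g\<close> is nonconstant, such points fill
  a punctured neighbourhood of every point.\<close>

locale pole_equation =
  fixes f g a b c :: "complex \<Rightarrow> complex"
  assumes f: "f meromorphic_on UNIV" and g: "g holomorphic_on UNIV" and g_nc: "\<not> g constant_on UNIV"
    and a: "a holomorphic_on UNIV" and b: "b holomorphic_on UNIV" and c: "c holomorphic_on UNIV"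
    and eq: "\<And>z. f analytic_on {z} \<Longrightarrow> f analytic_on {g z} \<Longrightarrow>
        deriv f z = a z * f (g z) + b z * f z + c z"
begin

lemma mero_at: "f meromorphic_on {z}"
  by (rule meromorphic_on_subset[OF f]) auto

lemma eventually_analytic: "\<forall>\<^sub>F z in at z0. f analytic_on {z}"
  using eventually_cosparse_imp_eventually_at[OF meromorphic_on_imp_analytic_cosparse[OF f]] by blast

lemma filterlim_g: "filterlim g (at (g z0)) (at z0)"
proof -
  have "isCont g z0" using holomorphic_on_imp_continuous_on[OF g] by (simp add: continuous_on_eq_continuous_at)
  thus ?thesis using entire_nonconstant_eventually_neq[OF g g_nc]
    by (simp add: filterlim_at isCont_def)
qed

lemma eventually_eq: "\<forall>\<^sub>F z in at z0. deriv f z = a z * f (g z) + b z * f z + c z"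
proof -
  have "\<forall>\<^sub>F z in at z0. f analytic_on {g z}"
    using eventually_analytic[of "g z0"] filterlim_g[of z0] by (rule eventually_compose_filterlim)
  with eventually_analytic[of z0] show ?thesis
    by eventually_elim (rule eq)
qed

text \<open>If \<open>z0\<close> were not a pole, f' - b f - c would have a finite limit there,
  whereas a f(g) tends to infinity.\<close>

lemma is_pole_backward:
  assumes "is_pole f (g z0)" "a z0 \<noteq> 0"
  shows "is_pole f z0"
proof (rule ccontr)
  assume "\<not> is_pole f z0"
  \<comment> \<open>Without a pole \<open>f\<close> may still have a wrong value at
    \<open>z0\<close>; \<open>remove_sings\<close> corrects it and makes the function analytic
    there.\<close>
  define F where "F = remove_sings f"
  have iso: "isolated_singularity_at f z0" using mero_at meromorphic_at_iff by blast
  have "F analytic_on {z0}" unfolding F_def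
    using \<open>\<not> is_pole f z0\<close> remove_sings_nicely_meromorphic[OF mero_at, of z0] iso
    by (intro nicely_meromorphic_on_imp_analytic_at[of _ "{z0}"]) auto
  then obtain S where S: "open S" "z0 \<in> S" "F holomorphic_on S" by (auto simp: analytic_at)
  have F_eq: "\<forall>\<^sub>F z in at z0. F z = f z \<and> deriv F z = deriv f z"
    using eventually_analytic[of z0] by eventually_elim (simp add: F_def)
  have cont: "isCont h z0" if "h holomorphic_on S" for h
    using that S(1,2) by (meson continuous_on_eq_continuous_at holomorphic_on_imp_continuous_on)
  have lim: "((\<lambda>z. deriv F z - b z * F z - c z) \<longlongrightarrow> deriv F z0 - b z0 * F z0 - c z0) (at z0)"
    using S b c by (intro isContD[OF cont] holomorphic_intros) (auto intro: holomorphic_on_subset)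
  have "is_pole (\<lambda>z. f (g z)) z0"
    unfolding is_pole_def using assms(1)[unfolded is_pole_def] filterlim_g by (rule filterlim_compose)
  hence "is_pole (\<lambda>z. a z * f (g z)) z0"
    using a assms(2) by (intro is_pole_mult_analytic_nonzero1) (auto intro: analytic_on_subset simp: analytic_on_open[OF open_UNIV, symmetric])
  hence "is_pole (\<lambda>z. deriv F z - b z * F z - c z) z0"
  proof (rule is_pole_cong[THEN iffD1, rotated 2])
    show "\<forall>\<^sub>F z in at z0. a z * f (g z) = deriv F z - b z * F z - c z"
      using eventually_eq[of z0] F_eq by eventually_elim simp
  qed simp
  with lim show False
    unfolding is_pole_def using not_tendsto_and_filterlim_at_infinity trivial_limit_at by blast
qed

lemma eventually_nonzero_at_pole:
  assumes "is_pole f w"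
  shows "\<forall>\<^sub>F z in at w. f z \<noteq> 0"
  using assms non_zero_neighbour_pole by blast

text \<open>Compare orders in a f(g) = f' - (b f + c). A simple preimage preserves the order of
  \<open>f\<close> at \<open>g z0\<close>; on the right f' dominates, its order being
  \<open>zorder f z0 - 1\<close> against at least \<open>zorder f z0\<close> for the rest.\<close>

lemma zorder_backward:
  assumes pole: "is_pole f (g z0)" and "a z0 \<noteq> 0" and simple: "deriv g z0 \<noteq> 0"
  shows "zorder f (g z0) = zorder f z0 - 1"
proof -
  have pole0: "is_pole f z0" using is_pole_backward assms by blast
  have iso: "isolated_singularity_at f z" "not_essential f z" for z
    using mero_at[of z] meromorphic_at_iff by blast+
  have ana: "h analytic_on {z}" if "h holomorphic_on UNIV" for h z
    using that by (auto intro: analytic_on_subset simp: analytic_on_open[OF open_UNIV, symmetric])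
  have mer: "h meromorphic_on {z}" if "h holomorphic_on UNIV" for h z
    using ana[OF that] by (rule analytic_on_imp_meromorphic_on)
  have "zorder (f \<circ> g) z0 = zorder f (g z0) * zorder (\<lambda>x. g x - g z0) z0"
    using iso ana[OF g] eventually_nonzero_at_pole[OF pole] entire_nonconstant_eventually_neq[OF g g_nc]
    by (intro zorder_compose') auto
  also have "zorder (\<lambda>x. g x - g z0) z0 = 1"
  proof (rule zorder_zero_eqI'[where n = 1, simplified])
    show "(\<lambda>x. g x - g z0) analytic_on {z0}" by (intro analytic_intros ana[OF g])
    have "((\<lambda>x. g x - g z0) has_field_derivative deriv g z0) (at z0)"
      using holomorphic_derivI[OF g, of z0] by (auto intro!: derivative_eq_intros)
    thus "deriv (\<lambda>x. g x - g z0) z0 \<noteq> 0" using simple by (simp add: DERIV_imp_deriv)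
  qed simp_all
  finally have order_comp: "zorder (f \<circ> g) z0 = zorder f (g z0)" by (simp only: mult_1_right)
  define h where "h = (\<lambda>z. a z * f (g z))"
  have ev_fg: "\<forall>\<^sub>F z in at z0. f (g z) \<noteq> 0"
    using eventually_nonzero_at_pole[OF pole] filterlim_g by (rule eventually_compose_filterlim)
  have ev_a: "\<forall>\<^sub>F z in at z0. a z \<noteq> 0"
    using analytic_at_neq_imp_eventually_neq[OF ana[OF a] assms(2)] .
  have mer_fg: "(f \<circ> g) meromorphic_on {z0}"
    unfolding meromorphic_at_iff o_def
    using isolated_singularity_at_compose[OF iso(1) ana[OF g]] not_essential_compose[OF iso(2) ana[OF g]] by blast
  have order_h: "zorder h z0 = zorder f (g z0)"
  proof -
    have "zorder h z0 = zorder a z0 + zorder (f \<circ> g) z0"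
      unfolding h_def o_def using mer[OF a] mer_fg ev_a ev_fg
      by (intro zorder_mult) (auto simp: o_def intro!: eventually_frequently)
    also have "zorder a z0 = 0" using ana[OF a] assms(2) by (intro zorder_eq_0I)
    finally show ?thesis using order_comp by (simp add: o_def)
  qed
  have m: "zorder f z0 < 0" using isolated_pole_imp_neg_zorder iso pole0 by blast
  have freq_f: "\<exists>\<^sub>F z in at z0. f z \<noteq> 0"
    using eventually_nonzero_at_pole[OF pole0] by (intro eventually_frequently) auto
  have order_deriv: "zorder (deriv f) z0 = zorder f z0 - 1"
    using iso freq_f m by (intro zorder_deriv_minus_1) auto
  have "is_pole (deriv f) z0" using is_pole_deriv_iff[OF mero_at] pole0 by blast
  hence freq_d: "\<exists>\<^sub>F z in at z0. deriv f z \<noteq> 0"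
    using non_zero_neighbour_pole by (intro eventually_frequently) auto
  have mer_d: "deriv f meromorphic_on {z0}" by (intro meromorphic_intros mero_at)
  define k where "k = (\<lambda>z. b z * f z + c z)"
  have mer_k: "k meromorphic_on {z0}"
    unfolding k_def by (intro meromorphic_intros mero_at mer b c)
  have "zorder h z0 = zorder (\<lambda>z. deriv f z - k z) z0"
    by (rule zorder_cong) (use eventually_eq[of z0] in \<open>auto elim!: eventually_mono simp: h_def k_def\<close>)
  also have "\<dots> = zorder f z0 - 1"
  proof (cases "\<exists>\<^sub>F z in at z0. k z \<noteq> 0")
    \<comment> \<open>The order is informative only for a function not vanishing identically near
      \<open>z0\<close>, so the vanishing of \<open>k\<close> is treated apart.\<close>
    case False
    hence "\<forall>\<^sub>F z in at z0. deriv f z - k z = deriv f z" by (auto simp: frequently_def elim: eventually_mono)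
    hence "zorder (\<lambda>z. deriv f z - k z) z0 = zorder (deriv f) z0" by (intro zorder_cong) auto
    thus ?thesis using order_deriv by simp
  next
    case True
    have "zorder k z0 \<ge> zorder f z0"
    proof -
      \<comment> \<open>Multiplying by a power series does not lower the subdegree, and adding one
        does not lower a negative subdegree.\<close>
      obtain F where F: "(\<lambda>w. f (z0 + w)) has_laurent_expansion F"
        using mero_at[of z0] by (auto simp: meromorphic_on_def)
      obtain B where B: "(\<lambda>w. b (z0 + w)) has_fps_expansion B"
        using analytic_at_imp_has_fps_expansion ana[OF b] by blast
      obtain C where C: "(\<lambda>w. c (z0 + w)) has_fps_expansion C"
        using analytic_at_imp_has_fps_expansion ana[OF c] by blast
      define K where "K = fps_to_fls B * F + fps_to_fls C"
      have K: "(\<lambda>w. k (z0 + w)) has_laurent_expansion K"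
        unfolding k_def K_def using B C
        by (intro laurent_expansion_intros F has_laurent_expansion_fps)
      have "K \<noteq> 0" using has_laurent_expansion_frequently_nonzero_iff[OF K] True by simp
      have "F \<noteq> 0" using has_laurent_expansion_frequently_nonzero_iff[OF F] freq_f by simp
      have oF: "zorder f z0 = fls_subdegree F" by (rule has_laurent_expansion_zorder[OF F \<open>F \<noteq> 0\<close>])
      have oK: "zorder k z0 = fls_subdegree K" by (rule has_laurent_expansion_zorder[OF K \<open>K \<noteq> 0\<close>])
      have "fls_subdegree F \<le> fls_subdegree (fps_to_fls B * F)"
        using \<open>F \<noteq> 0\<close> m oF fls_subdegree_fls_to_fps_gt0[of B] by (cases "B = 0") auto
      moreover have "fls_subdegree F \<le> fls_subdegree (fps_to_fls C)"
        using m oF fls_subdegree_fls_to_fps_gt0[of C] by linarith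
      ultimately show ?thesis
        using fls_plus_subdegree[of "fps_to_fls B * F" "fps_to_fls C"] \<open>K \<noteq> 0\<close>
        unfolding oF oK K_def by linarith
    qed
    hence "zorder (\<lambda>z. deriv f z - k z) z0 = zorder (deriv f) z0"
      using order_deriv by (intro zorder_diff1 mer_d mer_k freq_d True) auto
    thus ?thesis using order_deriv by simp
  qed
  finally show ?thesis using order_h by simp
qed

end

text \<open>Without multiple roots p - w is a product of distinct linear factors, so the fibre has
  \<open>degree p\<close> elements.\<close>

lemma card_simple_fibre_ge_2:
  fixes p :: "complex poly"
  assumes deg: "degree p \<ge> 2" and simple: "\<And>z. poly p z = w \<Longrightarrow> poly (pderiv p) z \<noteq> 0"
  shows "finite {z. poly p z = w}" "card {z. poly p z = w} \<ge> 2"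
proof -
  define q where "q = p + [:- w:]"
  have deg_q: "degree q = degree p" unfolding q_def using deg by (intro degree_add_eq_left) auto
  have q0: "q \<noteq> 0" using deg deg_q by auto
  have eq: "{z. poly p z = w} = {z. poly q z = 0}" by (auto simp: q_def)
  show fin: "finite {z. poly p z = w}" unfolding eq using q0 by (rule poly_roots_finite)
  have "rsquarefree q" unfolding rsquarefree_roots using simple by (auto simp: q_def pderiv_add pderiv_pCons eq_neg_iff_add_eq_0 add_eq_0_iff2)
  hence "q = smult (lead_coeff q) (\<Prod>z|poly q z = 0. [:-z, 1:])"
    using complex_poly_decompose_rsquarefree by simp
  hence "degree q = degree (\<Prod>z|poly q z = 0. [:-z, 1:])"
    using q0 by (metis degree_smult_eq leading_coeff_0_iff)
  also have "\<dots> = card {z. poly q z = 0}"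
    by (subst degree_prod_eq_sum_degree) auto
  finally show "card {z. poly p z = w} \<ge> 2" using deg deg_q eq by simp
qed

text \<open>Write p(z) = c + z r(z) with r nonconstant; far out |r| >= |c| + 1, which outweighs the
  constant term.\<close>

lemma norm_poly_ge_norm:
  fixes p :: "complex poly"
  assumes "degree p \<ge> 2"
  obtains R where "R > 0" "\<And>z. cmod z \<ge> R \<Longrightarrow> cmod (poly p z) \<ge> cmod z"
proof -
  obtain c r where p: "p = pCons c r" by (cases p)
  have "degree r \<noteq> 0" using assms p by (auto split: if_splits)
  hence "filterlim (poly r) at_infinity at_infinity" by (intro filterlim_poly_at_infinity) auto
  hence "\<forall>\<^sub>F z in at_infinity. cmod (poly r z) \<ge> cmod c + 1"
    unfolding filterlim_at_infinity[OF order_refl] using add_nonneg_pos[OF norm_ge_zero zero_less_one] by blast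
  then obtain R where R: "\<And>z. cmod z \<ge> R \<Longrightarrow> cmod (poly r z) \<ge> cmod c + 1"
    unfolding eventually_at_infinity by blast
  show thesis
  proof (rule that[of "max R 1"])
    fix z :: complex assume z: "cmod z \<ge> max R 1"
    have "cmod z * (cmod c + 1) \<le> cmod z * cmod (poly r z)" using R z by (intro mult_left_mono) auto
    moreover have "cmod z * cmod c \<ge> 1 * cmod c" using z by (intro mult_right_mono) auto
    ultimately have "cmod z + cmod c \<le> cmod (z * poly r z)" by (simp add: norm_mult distrib_left)
    also have "z * poly r z = poly p z - c" by (simp add: p)
    also have "cmod (poly p z - c) \<le> cmod (poly p z) + cmod c" by (rule norm_triangle_ineq4)
    finally show "cmod (poly p z) \<ge> cmod z" by simp
  qed simp
qed

section \<open>Finiteness of the set of poles\<close>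

context pole_equation
begin

lemma finite_poles_cball: "finite {z \<in> cball 0 r. is_pole f z}"
proof -
  have "{z. is_pole f z} sparse_in UNIV"
    using meromorphic_on_imp_not_pole_cosparse[OF f] by (simp add: eventually_cosparse)
  hence "finite (cball 0 r \<inter> {z. is_pole f z})"
    by (intro sparse_in_compact_finite) (auto intro: sparse_in_subset)
  thus ?thesis by (simp add: Int_def)
qed

lemma finite_poles_nonpolynomial:
  assumes a: "finite {z. a z = 0}" and g_poly: "\<nexists>p. g = poly p"
  shows "finite {z. is_pole f z}"
proof (rule ccontr)
  let ?P = "{z. is_pole f z}"
  assume inf: "infinite ?P"
  define W where "W = {w. finite {z. g z = w \<and> deriv g z \<noteq> 0}}"
  have W: "finite W" unfolding W_def by (rule finite_totally_ramified_values[OF g g_poly])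
  have "infinite (?P - W)" using inf W by simp
  hence "\<exists>w. w \<in> ?P - W" by (metis ex_in_conv finite.emptyI)
  \<comment> \<open>\<open>nat (- zorder f w)\<close> is the pole order as a natural number, so a
    pole of least order exists outside \<open>W\<close>.\<close>
  then obtain w where w: "w \<in> ?P - W"
    "\<And>z. z \<in> ?P - W \<Longrightarrow> nat (- zorder f w) \<le> nat (- zorder f z)"
    using ex_has_least_nat[of "\<lambda>w. w \<in> ?P - W" _ "\<lambda>w. nat (- zorder f w)"] by blast
  have "infinite {z. g z = w \<and> deriv g z \<noteq> 0}" using w(1) by (simp add: W_def)
  \<comment> \<open>The preimage must itself avoid \<open>W\<close>, so that minimality applies to
    it; an infinite simple fibre leaves room for this.\<close>
  hence "infinite ({z. g z = w \<and> deriv g z \<noteq> 0} - (W \<union> {z. a z = 0}))" using W a by simp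
  hence "{z. g z = w \<and> deriv g z \<noteq> 0} - (W \<union> {z. a z = 0}) \<noteq> {}" by (rule infinite_imp_nonempty)
  then obtain z where z: "g z = w" "deriv g z \<noteq> 0" "z \<notin> W" "a z \<noteq> 0" by blast
  have pole_z: "is_pole f z" using is_pole_backward[of z] z w by simp
  have "zorder f w = zorder f z - 1" using zorder_backward[of z] z w by simp
  moreover have "zorder f z < 0"
    using isolated_pole_imp_neg_zorder pole_z mero_at meromorphic_at_iff by blast
  ultimately have "nat (- zorder f z) < nat (- zorder f w)" by linarith
  moreover have "nat (- zorder f w) \<le> nat (- zorder f z)" using pole_z z by (intro w(2)) auto
  ultimately show False by linarith
qed

text \<open>Far out |g z| >= |z|, so preimages of points of a large disc stay in that disc. Each
  unexceptional pole there has at least two preimages, all poles again, and distinct fibres are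
  disjoint.\<close>

lemma finite_poles_polynomial:
  assumes a: "finite {z. a z = 0}" and g_poly: "g = poly p" "degree p \<ge> 2"
  shows "finite {z. is_pole f z}"
proof (rule ccontr)
  let ?P = "{z. is_pole f z}"
  assume inf: "infinite ?P"
  have "pderiv p \<noteq> 0" using g_poly by (auto simp: pderiv_eq_0_iff)
  \<comment> \<open>Outside \<open>V\<close> every preimage is simple and not a zero of
    \<open>a\<close>, so the whole fibre of a pole consists of poles.\<close>
  define V where "V = g ` ({z. a z = 0} \<union> {z. poly (pderiv p) z = 0})"
  have V: "finite V" unfolding V_def using a poly_roots_finite[OF \<open>pderiv p \<noteq> 0\<close>] by auto
  obtain R where R: "R > 0" "\<And>z. cmod z \<ge> R \<Longrightarrow> cmod (g z) \<ge> cmod z"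
    using norm_poly_ge_norm[OF g_poly(2)] unfolding g_poly(1) by blast
  \<comment> \<open>The count gives 2 (card N - card V) <= card N, that is card N <= 2 card V; one
    pole more contradicts it.\<close>
  obtain B where B: "B \<subseteq> ?P" "finite B" "card B = 2 * card V + 1"
    using infinite_arbitrarily_large[OF inf] by blast
  obtain r0 where r0: "\<And>z. z \<in> B \<Longrightarrow> cmod z \<le> r0"
    using B(2) by (meson finite_imp_bounded bounded_iff)
  define r where "r = max r0 R"
  define N where "N = {z \<in> cball 0 r. is_pole f z}"
  have N: "finite N" unfolding N_def by (rule finite_poles_cball)
  have fib: "finite {z. g z = w}" "card {z. g z = w} \<ge> 2" if "w \<notin> V" for w
    using card_simple_fibre_ge_2[OF g_poly(2), of w] that unfolding V_def g_poly(1) by auto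
  have "(\<Union>w\<in>N - V. {z. g z = w}) \<subseteq> N"
  proof safe
    fix z assume z: "g z \<in> N" "g z \<notin> V"
    have "is_pole f z" using is_pole_backward[of z] z by (auto simp: N_def V_def)
    moreover have "cmod z \<le> r"
    proof (rule ccontr)
      assume "\<not> cmod z \<le> r"
      hence "cmod z > r" "cmod z \<ge> R" by (auto simp: r_def)
      hence "cmod (g z) > r" using R(2)[of z] by linarith
      with z show False by (simp add: N_def)
    qed
    ultimately show "z \<in> N" by (simp add: N_def)
  qed
  hence "card (\<Union>w\<in>N - V. {z. g z = w}) \<le> card N" using N by (intro card_mono)
  also have "card (\<Union>w\<in>N - V. {z. g z = w}) = (\<Sum>w\<in>N - V. card {z. g z = w})"
    using N fib by (intro card_UN_disjoint) auto
  finally have "(\<Sum>w\<in>N - V. card {z. g z = w}) \<le> card N" .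
  moreover have "(\<Sum>w\<in>N - V. 2) \<le> (\<Sum>w\<in>N - V. card {z. g z = w})"
    using fib by (intro sum_mono) auto
  moreover have "card N - card V \<le> card (N - V)" using V by (rule diff_card_le_card_Diff)
  ultimately have "card N \<le> 2 * card V" by simp
  moreover have "card B \<le> card N" using B r0 N by (intro card_mono) (auto simp: N_def r_def max.coboundedI1)
  ultimately show False using B by simp
qed

lemma finite_poles:
  assumes a: "finite {z. a z = 0}" and g_nonaffine: "\<not> (\<exists>\<alpha> \<beta>. \<forall>z. g z = \<alpha> + \<beta> * z)"
  shows "finite {z. is_pole f z}"
proof (cases "\<exists>p. g = poly p")
  case True
  then obtain p where p: "g = poly p" by blast
  have "degree p \<ge> 2"
  proof (rule ccontr)
    assume "\<not> degree p \<ge> 2"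
    then obtain \<alpha> \<beta> where "p = [:\<alpha>, \<beta>:]"
      using degree1_coeffs degree_0_id by (metis One_nat_def less_2_cases not_le pCons_0_0 degree_eq_zeroE)
    hence "g z = \<alpha> + \<beta> * z" for z by (simp add: p mult.commute)
    with g_nonaffine show False by blast
  qed
  with a p show ?thesis by (rule finite_poles_polynomial)
qed (use a in \<open>rule finite_poles_nonpolynomial\<close>)

end

section \<open>Growth of entire functions\<close>

lemma entire_eq_finite_Taylor_sum:
  assumes g: "g holomorphic_on UNIV" and k: "\<And>k. k \<ge> n \<Longrightarrow> (deriv ^^ k) g 0 = 0"
  shows "g z = (\<Sum>k<n. (deriv ^^ k) g 0 / fact k * z ^ k)"
proof -
  have "(\<lambda>k. (deriv ^^ k) g 0 / fact k * (z - 0) ^ k) sums g z"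
    using g by (intro holomorphic_power_series[of _ _ "cmod z + 1"]) (auto intro: holomorphic_on_subset)
  moreover have "(\<lambda>k. (deriv ^^ k) g 0 / fact k * (z - 0) ^ k) sums
      (\<Sum>k<n. (deriv ^^ k) g 0 / fact k * (z - 0) ^ k)"
    by (rule sums_finite) (auto simp: k)
  ultimately have "g z = (\<Sum>k<n. (deriv ^^ k) g 0 / fact k * (z - 0) ^ k)"
    by (rule sums_unique2)
  thus ?thesis by simp
qed

text \<open>Cauchy's inequality read as a lower bound. The arbitrary bound \<open>B\<close> lets it
  be used both with an estimate from Schottky's theorem and with the maximum modulus.\<close>

lemma entire_growth:
  assumes g: "g holomorphic_on UNIV" and k: "(deriv ^^ k) g 0 \<noteq> 0"
  obtains c where "c > 0" "\<And>r B. r > 0 \<Longrightarrow> (\<And>z. cmod z = r \<Longrightarrow> cmod (g z) \<le> B) \<Longrightarrow> c * r ^ k \<le> B"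
proof -
  define c where "c = cmod ((deriv ^^ k) g 0) / fact k"
  show thesis
  proof (rule that[of c])
    show "c > 0" using k by (simp add: c_def)
    fix r B :: real assume r: "r > 0" and B: "\<And>z. cmod z = r \<Longrightarrow> cmod (g z) \<le> B"
    have "cmod ((deriv ^^ k) g 0) \<le> fact k * B / r ^ k"
      using g r B by (intro Cauchy_inequality) (auto intro: holomorphic_on_subset holomorphic_on_imp_continuous_on)
    thus "c * r ^ k \<le> B" using r by (simp add: c_def field_simps)
  qed
qed

text \<open>If the circles of radii \<open>\<rho>\<close> and 2 \<open>\<rho>\<close> both contained
  an omitted value, normalising these values to 0 and 1 would allow Schottky's theorem. It would
  bound g by (3 K + 1) \<open>\<rho>\<close> on |z| = r / 2, against the growth from a nonzero
  Taylor coefficient of index k >= 2.\<close>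

lemma entire_image_contains_circle:
  assumes g: "g holomorphic_on UNIV" and g_nonaffine: "\<not> (\<exists>\<alpha> \<beta>. \<forall>z. g z = \<alpha> + \<beta> * z)"
  obtains c R where "c > 0" "R > 0"
    "\<And>r. r \<ge> R \<Longrightarrow> \<exists>\<rho>\<ge>c * r\<^sup>2. \<forall>w. cmod w = \<rho> \<longrightarrow> (\<exists>z. cmod z \<le> r \<and> g z = w)"
proof -
  have "\<exists>k\<ge>2. (deriv ^^ k) g 0 \<noteq> 0"
  proof (rule ccontr)
    assume "\<not> ?thesis"
    hence zero: "(deriv ^^ k) g 0 = 0" if "k \<ge> 2" for k using that by blast
    have "{..<2::nat} = {0, 1}" by auto
    hence "g z = g 0 + deriv g 0 * z" for z
      using entire_eq_finite_Taylor_sum[where n = 2 and z = z, OF g zero] by simp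
    with g_nonaffine show False by blast
  qed
  then obtain k where k: "k \<ge> 2" "(deriv ^^ k) g 0 \<noteq> 0" by blast
  obtain c0 where c0: "c0 > 0"
    "\<And>r B. r > 0 \<Longrightarrow> (\<And>z. cmod z = r \<Longrightarrow> cmod (g z) \<le> B) \<Longrightarrow> c0 * r ^ k \<le> B"
    using entire_growth[OF g k(2)] by blast
  \<comment> \<open>Schottky's bound for |h 0| <= 2 on the disc of radius 1/2.\<close>
  define K where "K = exp (pi * exp (pi * (2 + 2 * 2 + 12 * (1/2) / (1 - 1/2 :: real))))"
  have K: "K > 0" by (simp add: K_def)
  \<comment> \<open>Makes (3 K + 1) c r^k exactly half of the lower bound c0 (r / 2)^k.\<close>
  define c where "c = c0 / 2 ^ k / (2 * (3 * K + 1))"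
  have c: "c > 0" using c0 K by (simp add: c_def)
  define R where "R = 1 + cmod (g 0) / c"
  show thesis
  proof (rule that[OF c])
    show R: "R > 0" using c by (simp add: R_def add_pos_nonneg)
    fix r assume r: "r \<ge> R"
    have "cmod (g 0) / c \<ge> 0" using c by simp
    hence r1: "r \<ge> 1" using r unfolding R_def by linarith
    define \<rho> where "\<rho> = c * r ^ k"
    have "r ^ 2 \<le> r ^ k" using r1 k by (intro power_increasing) auto
    hence \<rho>: "\<rho> \<ge> c * r\<^sup>2" using c by (simp add: \<rho>_def)
    have "r * 1 \<le> r * r" using r1 by (intro mult_left_mono) auto
    hence "c * r \<le> c * r\<^sup>2" using c by (simp add: power2_eq_square)
    moreover have "cmod (g 0) \<le> c * r" using r c by (simp add: R_def field_simps)
    ultimately have \<rho>_g: "cmod (g 0) \<le> \<rho>" using \<rho> by linarith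
    have \<rho>_pos: "\<rho> > 0" using c r1 by (simp add: \<rho>_def)
    show "\<exists>\<rho>\<ge>c * r\<^sup>2. \<forall>w. cmod w = \<rho> \<longrightarrow> (\<exists>z. cmod z \<le> r \<and> g z = w)"
    proof (rule ccontr)
      assume neg: "\<not> ?thesis"
      then obtain w1 where w1: "cmod w1 = \<rho>" "\<And>z. cmod z \<le> r \<Longrightarrow> g z \<noteq> w1"
        using \<rho> by blast
      have "2 * \<rho> \<ge> c * r\<^sup>2" using \<rho> \<rho>_pos by simp
      with neg obtain w2 where w2: "cmod w2 = 2 * \<rho>" "\<And>z. cmod z \<le> r \<Longrightarrow> g z \<noteq> w2"
        by blast
      have d: "\<rho> \<le> cmod (w2 - w1)" "cmod (w2 - w1) \<le> 3 * \<rho>"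
        using norm_triangle_ineq2[of w2 w1] norm_triangle_ineq4[of w2 w1] w1 w2 by auto
      have ne: "w2 - w1 \<noteq> 0" using d \<rho>_pos by auto
      define h where "h = (\<lambda>\<zeta>. (g (of_real r * \<zeta>) - w1) / (w2 - w1))"
      have h_le: "cmod (h \<zeta>) \<le> K" if "cmod \<zeta> \<le> 1 / 2" for \<zeta>
        unfolding K_def
      proof (rule Schottky[where f = h and z = \<zeta> and t = "1 / 2" and r = 2])
        show "h holomorphic_on cball 0 1"
          unfolding h_def using ne
          by (intro holomorphic_intros holomorphic_on_compose_gen[of "\<lambda>\<zeta>. of_real r * \<zeta>" _ g UNIV, unfolded o_def] g) auto
        have "cmod (h 0) = cmod (g 0 - w1) / cmod (w2 - w1)" by (simp add: h_def norm_divide)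
        also have "\<dots> \<le> (2 * \<rho>) / \<rho>"
          using norm_triangle_ineq4[of "g 0" w1] w1 \<rho>_g d \<rho>_pos by (intro frac_le) auto
        finally show "cmod (h 0) \<le> 2" using \<rho>_pos by simp
        fix z :: complex assume "z \<in> cball 0 1"
        hence "cmod (of_real r * z) \<le> r" using r1 by (simp add: norm_mult mult_left_le)
        from w1(2)[OF this] w2(2)[OF this] show "\<not> (h z = 0 \<or> h z = 1)"
          using ne by (auto simp: h_def field_simps)
      qed (use that in auto)
      have "cmod (g z) \<le> (3 * K + 1) * \<rho>" if z: "cmod z = r / 2" for z
      proof -
        have "cmod (z / of_real r) \<le> 1 / 2" using z r1 by (simp add: norm_divide)
        hence "cmod (h (z / of_real r)) \<le> K" by (rule h_le)
        hence "cmod (g z - w1) \<le> K * cmod (w2 - w1)"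
          using r1 ne by (simp add: h_def norm_divide field_simps)
        also have "\<dots> \<le> K * (3 * \<rho>)" using d K by (intro mult_left_mono) auto
        finally show ?thesis using norm_triangle_sub[of "g z" w1] w1(1) by (simp add: algebra_simps)
      qed
      hence "c0 * (r / 2) ^ k \<le> (3 * K + 1) * \<rho>" using r1 by (intro c0) auto
      also have "\<dots> = c0 * (r / 2) ^ k / 2"
      proof -
        define L where "L = 3 * K + 1"
        have "L > 0" using K by (simp add: L_def)
        thus ?thesis unfolding \<rho>_def c_def L_def[symmetric] by (simp add: power_divide)
      qed
      finally show False using c0(1) r1 by simp
    qed
  qed
qed

section \<open>Polynomial bounds, maximum modulus and the growth contradiction\<close>

lemma poly_norm_bound:
  fixes p :: "complex poly"
  obtains C where "C > 0" "\<And>z r k. r \<ge> 1 \<Longrightarrow> cmod z \<le> r \<Longrightarrow> degree p \<le> k \<Longrightarrow> cmod (poly p z) \<le> C * r ^ k"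
proof (rule that[of "1 + (\<Sum>i\<le>degree p. cmod (coeff p i))"])
  show "1 + (\<Sum>i\<le>degree p. cmod (coeff p i)) > 0" by (intro add_pos_nonneg sum_nonneg) auto
  fix z :: complex and r :: real and k assume r: "r \<ge> 1" "cmod z \<le> r" "degree p \<le> k"
  have "cmod (poly p z) \<le> (\<Sum>i\<le>degree p. cmod (coeff p i * z ^ i))"
    unfolding poly_altdef by (rule norm_sum)
  also have "\<dots> \<le> (\<Sum>i\<le>degree p. cmod (coeff p i) * r ^ k)"
  proof (rule sum_mono)
    fix i assume i: "i \<in> {..degree p}"
    have "cmod z ^ i \<le> r ^ i" using r by (intro power_mono) auto
    also have "\<dots> \<le> r ^ k" using r i by (intro power_increasing) auto
    finally show "cmod (coeff p i * z ^ i) \<le> cmod (coeff p i) * r ^ k"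
      by (simp add: norm_mult norm_power mult_left_mono)
  qed
  also have "\<dots> \<le> (1 + (\<Sum>i\<le>degree p. cmod (coeff p i))) * r ^ k"
    using r by (simp add: distrib_right sum_distrib_right)
  finally show "cmod (poly p z) \<le> (1 + (\<Sum>i\<le>degree p. cmod (coeff p i))) * r ^ k" .
qed

lemma poly_norm_lower_bound:
  fixes p :: "complex poly"
  assumes "p \<noteq> 0"
  obtains \<delta> R where "\<delta> > 0" "\<And>z. cmod z \<ge> R \<Longrightarrow> cmod (poly p z) \<ge> \<delta>"
proof (cases "degree p = 0")
  case True
  then obtain c where "p = [:c:]" by (rule degree_eq_zeroE)
  with assms that[of "cmod c" 0] show thesis by auto
next
  case False
  hence "filterlim (poly p) at_infinity at_infinity" by (intro filterlim_poly_at_infinity) auto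
  hence "\<forall>\<^sub>F z in at_infinity. cmod (poly p z) \<ge> 1"
    unfolding filterlim_at_infinity[OF order_refl] by auto
  with that[of 1] show thesis unfolding eventually_at_infinity by auto
qed

definition max_modulus :: "(complex \<Rightarrow> complex) \<Rightarrow> real \<Rightarrow> real" where
  "max_modulus F r = Sup ((\<lambda>z. cmod (F z)) ` sphere 0 r)"

lemma max_modulus_attained:
  assumes F: "F holomorphic_on UNIV" and r: "r \<ge> 0"
  obtains w where "cmod w = r" "cmod (F w) = max_modulus F r"
    "\<And>z. cmod z \<le> r \<Longrightarrow> cmod (F z) \<le> max_modulus F r"
proof -
  have "compact ((\<lambda>z. cmod (F z)) ` sphere 0 r)"
    using F by (intro compact_continuous_image continuous_intros holomorphic_on_imp_continuous_on)
      (auto intro: holomorphic_on_subset)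
  moreover have "of_real r \<in> sphere (0 :: complex) r" using r by simp
  ultimately obtain w where w: "w \<in> sphere 0 r" "\<And>z. z \<in> sphere 0 r \<Longrightarrow> cmod (F z) \<le> cmod (F w)"
    using compact_attains_sup[of "(\<lambda>z. cmod (F z)) ` sphere 0 r"] by blast
  have eq: "max_modulus F r = cmod (F w)"
    unfolding max_modulus_def using w by (intro cSup_eq_maximum) auto
  show thesis
  proof (rule that[of w])
    fix z assume z: "cmod z \<le> r"
    show "cmod (F z) \<le> max_modulus F r"
    proof (cases "r = 0")
      case False
      have "cmod (F z) \<le> cmod (F w)"
      proof (rule maximum_modulus_frontier[of F "cball 0 r"])
        show "cmod (F z') \<le> cmod (F w)" if "z' \<in> frontier (cball 0 r)" for z'
          using that w(2) r False by (simp add: frontier_cball)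
      qed (use F z in \<open>auto intro: holomorphic_on_subset holomorphic_on_imp_continuous_on\<close>)
      thus ?thesis by (simp add: eq)
    qed (use z w eq in auto)
  qed (use w eq in auto)
qed

text \<open>The maximum principle for F(z) / z^N on the annulus 1 < |z| < \<open>\<rho>\<close>
  bounds it by its values on the two circles, and for large r the inner circle cannot be decisive.
  Thus max_modulus F r / r^N is eventually nondecreasing.\<close>

lemma max_modulus_power_growth:
  assumes F: "F holomorphic_on UNIV" and F_poly: "\<nexists>p. F = poly p"
  obtains R where "R > 1" "\<And>r \<rho>. r \<ge> R \<Longrightarrow> \<rho> > r \<Longrightarrow> max_modulus F r \<le> (r / \<rho>) ^ N * max_modulus F \<rho>"
     "\<And>r. r \<ge> R \<Longrightarrow> max_modulus F r \<ge> 1"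
proof -
  \<comment> \<open>An index beyond N supplies one spare power of r, which beats the constant
    \<open>max_modulus F 1 + 1\<close>.\<close>
  have "\<exists>k\<ge>Suc N. (deriv ^^ k) F 0 \<noteq> 0"
  proof (rule ccontr)
    assume "\<not> ?thesis"
    hence zero: "(deriv ^^ k) F 0 = 0" if "k \<ge> Suc N" for k using that by blast
    have "F z = (\<Sum>k<Suc N. (deriv ^^ k) F 0 / fact k * z ^ k)" for z
      by (rule entire_eq_finite_Taylor_sum[OF F zero])
    hence "F = poly (\<Sum>k<Suc N. monom ((deriv ^^ k) F 0 / fact k) k)"
      by (intro ext) (simp only: poly_sum poly_monom)
    with F_poly show False by blast
  qed
  then obtain k where k: "k \<ge> Suc N" "(deriv ^^ k) F 0 \<noteq> 0" by blast
  obtain c where c: "c > 0"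
    "\<And>r B. r > 0 \<Longrightarrow> (\<And>z. cmod z = r \<Longrightarrow> cmod (F z) \<le> B) \<Longrightarrow> c * r ^ k \<le> B"
    using entire_growth[OF F k(2)] by blast
  have M: "cmod (F z) \<le> max_modulus F r" if "cmod z \<le> r" for z r
    using max_modulus_attained[OF F] that by (metis norm_ge_zero order_trans)
  have M_nonneg: "0 \<le> max_modulus F r" if "r \<ge> 0" for r
    using max_modulus_attained[OF F that] by (metis norm_ge_zero)
  define R where "R = 2 + (max_modulus F 1 + 1) / c"
  have Rc: "(max_modulus F 1 + 1) / c \<ge> 0" using c M_nonneg[of 1] by simp
  have large: "max_modulus F r > (max_modulus F 1 + 1) * r ^ N" if r: "r \<ge> R" for r
  proof -
    have r1: "r \<ge> 1" using r Rc by (simp add: R_def)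
    have "(max_modulus F 1 + 1) < c * r" using r c by (simp add: R_def field_simps)
    hence "(max_modulus F 1 + 1) * r ^ N < c * r * r ^ N" using r1 by (intro mult_strict_right_mono) auto
    also have "\<dots> = c * r ^ Suc N" by simp
    also have "\<dots> \<le> c * r ^ k" using c r1 k by (intro mult_left_mono power_increasing) auto
    also have "\<dots> \<le> max_modulus F r" using M r1 by (intro c) auto
    finally show ?thesis .
  qed
  show thesis
  proof (rule that)
    show "R > 1" using Rc by (simp add: R_def)
    show "max_modulus F r \<ge> 1" if r: "r \<ge> R" for r
    proof -
      have r1: "r \<ge> 1" using r Rc by (simp add: R_def)
      have "1 * 1 \<le> (max_modulus F 1 + 1) * r ^ N"
        using M_nonneg[of 1] r1 by (intro mult_mono one_le_power) auto
      with large[OF r] show ?thesis by simp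
    qed
    fix r \<rho> assume r: "r \<ge> R" and \<rho>: "\<rho> > r"
    have r1: "r > 1" using r Rc by (simp add: R_def)
    define B where "B = max (max_modulus F 1) (max_modulus F \<rho> / \<rho> ^ N)"
    obtain w where w: "cmod w = r" "cmod (F w) = max_modulus F r"
      using max_modulus_attained[OF F, of r] r1 by auto
    define S where "S = ball 0 \<rho> - cball (0 :: complex) 1"
    have clS: "closure S \<subseteq> cball 0 \<rho> - ball 0 1"
      by (rule closure_minimal) (auto simp: S_def)
    have oS: "open S" by (auto simp: S_def)
    have "cmod (F w / w ^ N) \<le> B"
    proof (rule maximum_modulus_frontier[of "\<lambda>z. F z / z ^ N" S])
      have "(\<lambda>z. F z / z ^ N) holomorphic_on - {0}"
        using F by (intro holomorphic_intros) (auto intro: holomorphic_on_subset)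
      moreover have "closure S \<subseteq> - {0}" using clS by auto
      ultimately show "continuous_on (closure S) (\<lambda>z. F z / z ^ N)"
        "(\<lambda>z. F z / z ^ N) holomorphic_on interior S"
        using closure_subset[of S] interior_subset[of S]
        by (meson holomorphic_on_imp_continuous_on holomorphic_on_subset subset_trans)+
      show "bounded S" unfolding S_def by (intro bounded_diff) auto
      show "w \<in> S" using w r1 \<rho> by (simp add: S_def)
      fix z assume "z \<in> frontier S"
      hence "z \<in> closure S" "z \<notin> S" using oS by (auto simp: frontier_def interior_open)
      hence "cmod z = 1 \<or> cmod z = \<rho>" using clS by (auto simp: S_def)
      thus "cmod (F z / z ^ N) \<le> B"
      proof
        assume "cmod z = 1"
        thus ?thesis using M[of z 1] by (simp add: B_def norm_divide norm_power)
      next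
        assume "cmod z = \<rho>"
        thus ?thesis using M[of z \<rho>] r1 \<rho> by (auto simp: B_def norm_divide norm_power divide_right_mono max.coboundedI2)
      qed
    qed
    hence le: "max_modulus F r \<le> B * r ^ N" using w r1 by (simp add: norm_divide norm_power field_simps)
    have "B \<noteq> max_modulus F 1"
    proof
      assume "B = max_modulus F 1"
      hence "max_modulus F r \<le> max_modulus F 1 * r ^ N" using le by simp
      also have "\<dots> \<le> (max_modulus F 1 + 1) * r ^ N" using r1 by (intro mult_right_mono) auto
      finally have "max_modulus F r \<le> (max_modulus F 1 + 1) * r ^ N" .
      with large[OF r] show False by simp
    qed
    hence "B = max_modulus F \<rho> / \<rho> ^ N" by (auto simp: B_def max_def split: if_splits)
    with le show "max_modulus F r \<le> (r / \<rho>) ^ N * max_modulus F \<rho>"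
      by (simp add: power_divide mult.commute)
  qed
qed

lemma polynomial_growth_contradiction:
  fixes F g :: "complex \<Rightarrow> complex" and A Q p1 p2 p3 :: "complex poly"
  assumes F: "F holomorphic_on UNIV" and F_poly: "\<nexists>p. F = poly p"
    and g: "g holomorphic_on UNIV" and g_nonaffine: "\<not> (\<exists>\<alpha> \<beta>. \<forall>z. g z = \<alpha> + \<beta> * z)"
    and A: "A \<noteq> 0"
    and eq: "\<And>z. poly A z * F (g z) =
               poly Q (g z) * (deriv F z * poly p1 z + F z * poly p2 z + poly p3 z)"
  shows False
proof -
  define K where "K = max (degree p1) (max (degree p2) (degree p3))"
  define q where "q = degree Q"
  \<comment> \<open>Solves 2 (N - q) = (K + N) + 1, so that after inserting \<open>\<rho>\<close> >=
    c r^2 exactly one negative power of r survives.\<close>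
  define N where "N = K + 2 * q + 1"
  obtain c R0 where c: "c > 0" "R0 > 0"
    "\<And>r. r \<ge> R0 \<Longrightarrow> \<exists>\<rho>\<ge>c * r\<^sup>2. \<forall>w. cmod w = \<rho> \<longrightarrow> (\<exists>z. cmod z \<le> r \<and> g z = w)"
    using entire_image_contains_circle[OF g g_nonaffine] by blast
  obtain R1 where R1: "R1 > 1"
     "\<And>r \<rho>. r \<ge> R1 \<Longrightarrow> \<rho> > r \<Longrightarrow> max_modulus F r \<le> (r / \<rho>) ^ N * max_modulus F \<rho>"
     "\<And>r. r \<ge> R1 \<Longrightarrow> max_modulus F r \<ge> 1"
    using max_modulus_power_growth[OF F F_poly, of N] by blast
  obtain \<delta> R2 where \<delta>: "\<delta> > 0" "\<And>z. cmod z \<ge> R2 \<Longrightarrow> cmod (poly A z) \<ge> \<delta>"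
    using poly_norm_lower_bound[OF A] by blast
  obtain C1 where C1: "C1 > 0" "\<And>z r k. r \<ge> 1 \<Longrightarrow> cmod z \<le> r \<Longrightarrow> degree p1 \<le> k \<Longrightarrow> cmod (poly p1 z) \<le> C1 * r ^ k"
    using poly_norm_bound by blast
  obtain C2 where C2: "C2 > 0" "\<And>z r k. r \<ge> 1 \<Longrightarrow> cmod z \<le> r \<Longrightarrow> degree p2 \<le> k \<Longrightarrow> cmod (poly p2 z) \<le> C2 * r ^ k"
    using poly_norm_bound by blast
  obtain C3 where C3: "C3 > 0" "\<And>z r k. r \<ge> 1 \<Longrightarrow> cmod z \<le> r \<Longrightarrow> degree p3 \<le> k \<Longrightarrow> cmod (poly p3 z) \<le> C3 * r ^ k"
    using poly_norm_bound by blast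
  obtain CQ where CQ: "CQ > 0" "\<And>z r k. r \<ge> 1 \<Longrightarrow> cmod z \<le> r \<Longrightarrow> degree Q \<le> k \<Longrightarrow> cmod (poly Q z) \<le> CQ * r ^ k"
    using poly_norm_bound by blast
  have "compact (g ` cball 0 R2)"
    using g by (intro compact_continuous_image holomorphic_on_imp_continuous_on) (auto intro: holomorphic_on_subset)
  then obtain B where B: "\<And>z. cmod z \<le> R2 \<Longrightarrow> cmod (g z) \<le> B"
    using compact_imp_bounded[of "g ` cball 0 R2"] by (force simp: bounded_iff)
  define C where "C = CQ * (C1 + C2 + C3)"
  have C: "C > 0" using CQ C1 C2 C3 by (simp add: C_def)
  define D where "D = C * 2 ^ N / c ^ (N - q)"
  have D: "D > 0" using C c by (simp add: D_def)
  \<comment> \<open>Here 3 / c yields \<open>\<rho>\<close> > 2 r; the term with \<open>B\<close>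
    yields \<open>\<rho>\<close> > B, forcing the preimage of \<open>w\<close> out to where
    \<open>A\<close> is bounded below; D / \<open>\<delta>\<close> makes the final D / r smaller
    than \<open>\<delta>\<close>.\<close>
  define r where "r = 2 + R0 + R1 + 3 / c + \<bar>B\<bar> / c + D / \<delta>"
  have nonneg: "3 / c \<ge> 0" "\<bar>B\<bar> / c \<ge> 0" "D / \<delta> \<ge> 0" using c D \<delta> by auto
  have r: "r \<ge> 1" "r \<ge> R0" "r \<ge> R1" "r > 3 / c" "r > \<bar>B\<bar> / c" "r > D / \<delta>"
    using nonneg c R1 unfolding r_def by linarith+
  obtain \<rho> where \<rho>: "\<rho> \<ge> c * r\<^sup>2" "\<And>w. cmod w = \<rho> \<Longrightarrow> \<exists>z. cmod z \<le> r \<and> g z = w"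
    using c(3)[OF r(2)] by blast
  have "3 * r < c * r\<^sup>2" using r(1,4) c(1) by (simp add: power2_eq_square field_simps)
  hence \<rho>1: "\<rho> > 2 * r" "\<rho> \<ge> 1" using \<rho>(1) r(1) by linarith+
  have "c * r * 1 \<le> c * r * r" using r(1) c(1) by (intro mult_left_mono) auto
  moreover have "\<bar>B\<bar> < c * r" using r(5) c(1) by (simp add: field_simps)
  ultimately have \<rho>B: "\<rho> > B" using \<rho>(1) by (simp add: power2_eq_square)
  obtain w where w: "cmod w = \<rho>" "cmod (F w) = max_modulus F \<rho>"
    using max_modulus_attained[OF F, of \<rho>] \<rho>1 by auto
  obtain z where z: "cmod z \<le> r" "g z = w" using \<rho>(2)[OF w(1)] by blast
  have "cmod z > R2" using B[of z] z w \<rho>B by (meson leD not_le)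
  hence Az: "cmod (poly A z) \<ge> \<delta>" by (intro \<delta>) simp
  define M where "M = max_modulus F (2 * r)"
  have M1: "M \<ge> 1" unfolding M_def using r by (intro R1) auto
  have F_le: "cmod (F \<zeta>) \<le> M" if "cmod \<zeta> \<le> 2 * r" for \<zeta>
    unfolding M_def using max_modulus_attained[OF F, of "2 * r"] that r(1) by (metis norm_ge_zero order_trans)
  have F'_le: "cmod (deriv F z) \<le> M"
  proof -
    \<comment> \<open>The circle of radius r about \<open>z\<close> stays within |x| <= 2 r, hence
      the argument 2 r in \<open>M\<close>.\<close>
    have "cmod ((deriv ^^ 1) F z) \<le> fact 1 * M / r ^ 1"
    proof (rule Cauchy_inequality)
      fix x assume "cmod (z - x) = r"
      hence "cmod x \<le> 2 * r" using norm_triangle_ineq4[of z "z - x"] z(1) by simp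
      thus "cmod (F x) \<le> M" by (rule F_le)
    qed (use F r in \<open>auto intro: holomorphic_on_subset holomorphic_on_imp_continuous_on\<close>)
    also have "\<dots> \<le> M" using r(1) M1 by (simp add: field_simps mult_left_le)
    finally show ?thesis by simp
  qed
  have "\<delta> * max_modulus F \<rho> \<le> cmod (poly A z * F (g z))"
    unfolding norm_mult z(2) w(2)[symmetric] using Az by (intro mult_right_mono) auto
  also have "\<dots> = cmod (poly Q w) * cmod (deriv F z * poly p1 z + F z * poly p2 z + poly p3 z)"
    unfolding eq unfolding z(2) by (rule norm_mult)
  also have "\<dots> \<le> (CQ * \<rho> ^ q) * ((C1 + C2 + C3) * r ^ K * M)"
  proof (rule mult_mono)
    show "cmod (poly Q w) \<le> CQ * \<rho> ^ q" using CQ(2)[of \<rho> w q] \<rho>1 w by (simp add: q_def)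
    have "cmod (deriv F z * poly p1 z + F z * poly p2 z + poly p3 z)
        \<le> cmod (deriv F z) * cmod (poly p1 z) + cmod (F z) * cmod (poly p2 z) + 1 * cmod (poly p3 z)"
      by (intro order_trans[OF norm_triangle_ineq] add_mono) (auto simp: norm_mult)
    also have "\<dots> \<le> M * (C1 * r ^ K) + M * (C2 * r ^ K) + M * (C3 * r ^ K)"
      using F'_le F_le[of z] M1 z(1) r(1)
      by (intro add_mono mult_mono C1 C2 C3) (auto simp: K_def)
    finally show "cmod (deriv F z * poly p1 z + F z * poly p2 z + poly p3 z) \<le> (C1 + C2 + C3) * r ^ K * M"
      by (simp add: algebra_simps)
  qed (use CQ \<rho>1 in auto)
  also have "\<dots> = C * \<rho> ^ q * r ^ K * M" by (simp add: C_def)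
  also have "\<dots> \<le> C * \<rho> ^ q * r ^ K * ((2 * r / \<rho>) ^ N * max_modulus F \<rho>)"
    unfolding M_def using R1(2)[of "2 * r" \<rho>] r \<rho>1 C by (intro mult_left_mono) auto
  finally have "\<delta> * max_modulus F \<rho> \<le> (C * \<rho> ^ q * r ^ K * (2 * r / \<rho>) ^ N) * max_modulus F \<rho>"
    by (simp only: mult.assoc)
  moreover have "max_modulus F \<rho> > 0" using R1(3)[of \<rho>] r \<rho>1 by linarith
  ultimately have "\<delta> \<le> C * \<rho> ^ q * r ^ K * (2 * r / \<rho>) ^ N"
    by (simp only: mult_le_cancel_right_pos)
  also have "\<dots> = C * 2 ^ N * r ^ (K + N) * (\<rho> ^ q / \<rho> ^ N)"
    by (simp add: power_divide power_mult_distrib power_add)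
  also have "\<rho> ^ q / \<rho> ^ N = 1 / \<rho> ^ (N - q)"
  proof -
    have "q + (N - q) = N" by (simp add: N_def)
    hence "\<rho> ^ N = \<rho> ^ q * \<rho> ^ (N - q)" by (metis power_add)
    thus ?thesis using \<rho>1 by simp
  qed
  also have "C * 2 ^ N * r ^ (K + N) * (1 / \<rho> ^ (N - q)) \<le> C * 2 ^ N * r ^ (K + N) * (1 / (c * r\<^sup>2) ^ (N - q))"
    using C r c \<rho> \<rho>1 by (intro mult_left_mono divide_left_mono power_mono mult_pos_pos zero_less_power) auto
  also have "\<dots> = D * (r ^ (K + N) / r ^ (2 * (N - q)))"
    by (simp add: D_def power_mult_distrib power_mult)
  also have "2 * (N - q) = (K + N) + 1" by (simp add: N_def)
  also have "D * (r ^ (K + N) / r ^ ((K + N) + 1)) = D / r" using r(1) by simp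
  also have "\<dots> < \<delta>" using r(1,6) \<delta>(1) by (simp add: field_simps)
  finally show False by simp
qed

section \<open>The equation in one variable\<close>

text \<open>Multiplying by one linear factor per pole, raised to its order, leaves only removable
  singularities. The equality is given on a neighbourhood so that it can be differentiated.\<close>

lemma meromorphic_finite_poles_cleared:
  assumes f: "f meromorphic_on UNIV" and fin: "finite {z. is_pole f z}"
  obtains F and Q :: "complex poly" where "F holomorphic_on UNIV" "Q \<noteq> 0"
    "\<And>z. f analytic_on {z} \<Longrightarrow> \<forall>\<^sub>F w in nhds z. F w = f w * poly Q w"
proof -
  define P where "P = {z. is_pole f z}"
  define n where "n = (\<lambda>p. nat (- zorder f p))"
  define Q where "Q = (\<Prod>p\<in>P. [:- p, 1:] ^ n p)"
  define F0 where "F0 = (\<lambda>z. f z * poly Q z)"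
  have Q: "Q \<noteq> 0" using fin by (simp add: Q_def P_def)
  have iso: "isolated_singularity_at f z" "not_essential f z" for z
    using meromorphic_on_subset[OF f, of "{z}"] meromorphic_at_iff by blast+
  have "F0 meromorphic_on UNIV"
    unfolding F0_def by (intro meromorphic_intros f analytic_on_imp_meromorphic_on)
      (auto simp: analytic_on_open intro: holomorphic_intros)
  hence iso0: "isolated_singularity_at F0 z" for z
    using meromorphic_on_subset[of F0 UNIV "{z}"] meromorphic_at_iff by blast
  have lim: "\<exists>l. F0 \<midarrow>z\<rightarrow> l" for z
  proof (cases "is_pole f z")
    case False
    then obtain l where "f \<midarrow>z\<rightarrow> l" using iso(2)[of z] by (auto simp: not_essential_def)
    moreover have "poly Q \<midarrow>z\<rightarrow> poly Q z" using isContD[OF poly_isCont] by blast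
    ultimately have "F0 \<midarrow>z\<rightarrow> l * poly Q z" unfolding F0_def by (rule tendsto_mult)
    thus ?thesis by blast
  next
    case True
    obtain r where r: "r > 0" "f analytic_on ball z r - {z}"
      using iso(1)[of z] by (auto simp: isolated_singularity_at_def)
    have "f holomorphic_on ball z r - {z}" using r(2) by (rule analytic_imp_holomorphic)
    from zorder_exist_pole[OF this _ _ True] r(1) obtain e where e: "e > 0" "cball z e \<subseteq> ball z r"
       "zor_poly f z holomorphic_on cball z e"
       "\<And>w. w \<in> cball z e - {z} \<Longrightarrow> f w = zor_poly f z w / (w - z) ^ n z"
      unfolding n_def by (metis open_ball centre_in_ball)
    define Q' where "Q' = (\<Prod>p\<in>P - {z}. [:- p, 1:] ^ n p)"
    have Q_eq: "poly Q w = (w - z) ^ n z * poly Q' w" for w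
      unfolding Q_def Q'_def using fin True by (subst prod.remove[of P z]) (auto simp: P_def)
    define h where "h = (\<lambda>w. zor_poly f z w * poly Q' w)"
    have "h holomorphic_on ball z e" unfolding h_def using e(3)
      by (intro holomorphic_intros) (auto intro: holomorphic_on_subset)
    hence "isCont h z"
      using e(1) by (meson centre_in_ball continuous_on_eq_continuous_at holomorphic_on_imp_continuous_on open_ball)
    hence "h \<midarrow>z\<rightarrow> h z" by (rule isContD)
    moreover have "\<forall>\<^sub>F w in at z. h w = F0 w"
    proof -
      have "\<forall>\<^sub>F w in at z. w \<in> ball z e - {z}" using e(1) by (intro eventually_at_in_open) auto
      thus ?thesis by eventually_elim (use e(4) in \<open>auto simp: F0_def h_def Q_eq\<close>)
    qed
    ultimately have "F0 \<midarrow>z\<rightarrow> h z" by (rule Lim_transform_eventually)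
    thus ?thesis by blast
  qed
  show thesis
  proof (rule that[of "remove_sings F0" Q])
    have "remove_sings F0 analytic_on {z}" for z
      using lim[of z] remove_sings_analytic_at[OF iso0] by blast
    hence "remove_sings F0 analytic_on UNIV" using analytic_on_analytic_at by blast
    thus "remove_sings F0 holomorphic_on UNIV" by (rule analytic_imp_holomorphic)
    fix z assume "f analytic_on {z}"
    moreover have "poly Q analytic_on {z}"
      by (rule analytic_on_subset[of _ UNIV]) (auto simp: analytic_on_open intro: holomorphic_intros)
    ultimately have "F0 analytic_on {z}" unfolding F0_def by (rule analytic_on_mult)
    from eventually_remove_sings_eq_nhds[OF this]
    show "\<forall>\<^sub>F w in nhds z. remove_sings F0 w = f w * poly Q w" by (simp add: F0_def)
  qed (rule Q)
qed

lemma entire_eq_if_eventually_eq_at: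
  fixes F H :: "complex \<Rightarrow> complex"
  assumes "F holomorphic_on UNIV" "H holomorphic_on UNIV" "\<forall>\<^sub>F z in at z0. F z = H z"
  shows "F z0 = H z0"
proof -
  have "F \<midarrow>z0\<rightarrow> F z0" "H \<midarrow>z0\<rightarrow> H z0"
    using assms(1,2) by (meson UNIV_I continuous_on_eq_continuous_at holomorphic_on_imp_continuous_on isContD open_UNIV)+
  moreover from this(1) have "H \<midarrow>z0\<rightarrow> F z0" using assms(3) by (rule Lim_transform_eventually)
  ultimately show ?thesis using LIM_unique by blast
qed

lemma entire_affine_if_equation:
  fixes f g :: "complex \<Rightarrow> complex" and a b c :: "complex poly"
  assumes f: "f meromorphic_on UNIV" and f_nonrational: "\<not> rational_mero f"
    and g: "g holomorphic_on UNIV" and a_nz: "a \<noteq> 0"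
    and eq: "\<And>z. f analytic_on {z} \<Longrightarrow> f analytic_on {g z} \<Longrightarrow>
        deriv f z = poly a z * f (g z) + poly b z * f z + poly c z"
  shows "\<exists>\<alpha> \<beta>. \<forall>z. g z = \<alpha> + \<beta> * z"
proof (rule ccontr)
  assume nonaffine: "\<not> (\<exists>\<alpha> \<beta>. \<forall>z. g z = \<alpha> + \<beta> * z)"
  have nc: "\<not> g constant_on UNIV"
  proof
    assume "g constant_on UNIV"
    then obtain \<alpha> where "\<forall>z. g z = \<alpha> + 0 * z" by (auto simp: constant_on_def)
    with nonaffine show False by blast
  qed
  interpret pole_equation f g "poly a" "poly b" "poly c"
    by unfold_locales (use f g nc eq in \<open>auto intro: holomorphic_intros\<close>)
  have "finite {z. is_pole f z}"
    using finite_poles[OF poly_roots_finite[OF a_nz] nonaffine] .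
  then obtain F Q where F: "F holomorphic_on UNIV" and Q: "Q \<noteq> 0"
    and F_eq: "\<And>z. f analytic_on {z} \<Longrightarrow> \<forall>\<^sub>F w in nhds z. F w = f w * poly Q w"
    using meromorphic_finite_poles_cleared[OF f] by metis
  have F_val: "F z = f z * poly Q z" if "f analytic_on {z}" for z
    using eventually_nhds_x_imp_x[OF F_eq[OF that]] .
  have F_deriv: "deriv F z = deriv f z * poly Q z + f z * poly (pderiv Q) z" if z: "f analytic_on {z}" for z
  proof -
    have "deriv F z = deriv (\<lambda>w. f w * poly Q w) z" using F_eq[OF z] by (intro deriv_cong_ev) auto
    also have "\<dots> = deriv f z * poly Q z + f z * poly (pderiv Q) z"
    proof (rule DERIV_imp_deriv)
      have "(f has_field_derivative deriv f z) (at z)"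
        using analytic_on_imp_differentiable_at[OF z] DERIV_deriv_iff_field_differentiable by blast
      thus "((\<lambda>w. f w * poly Q w) has_field_derivative deriv f z * poly Q z + f z * poly (pderiv Q) z) (at z)"
        by (auto intro!: derivative_eq_intros)
    qed
    finally show ?thesis .
  qed
  have not_poly: "\<nexists>p. F = poly p"
  proof
    assume "\<exists>p. F = poly p"
    then obtain p where p: "F = poly p" by blast
    have "{z. poly Q z = 0} sparse_in UNIV" using poly_roots_finite[OF Q] by (rule finite_imp_sparse)
    hence "\<forall>\<^sub>\<approx>z. poly Q z \<noteq> 0" by (simp add: eventually_cosparse)
    with meromorphic_on_imp_analytic_cosparse[OF f]
    have "\<forall>\<^sub>\<approx>z. f z = poly p z / poly Q z"
      by eventually_elim (use F_val p in \<open>auto simp: field_simps\<close>)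
    with Q f_nonrational show False by (auto simp: rational_mero_def)
  qed
  show False
  \<comment> \<open>Substituting f = F / Q and multiplying by Q(z)^2 Q(g z) gives a Q^2 F(g) = Q(g)
    (F' Q - F Q' - b Q F - c Q^2).\<close>
  proof (rule polynomial_growth_contradiction[OF F not_poly g nonaffine])
    show "a * Q\<^sup>2 \<noteq> 0" using a_nz Q by simp
    fix z0
    show "poly (a * Q\<^sup>2) z0 * F (g z0) =
      poly Q (g z0) * (deriv F z0 * poly Q z0 + F z0 * poly (- pderiv Q - b * Q) z0 + poly (- c * Q\<^sup>2) z0)"
    proof (rule entire_eq_if_eventually_eq_at[of
          "\<lambda>z. poly (a * Q\<^sup>2) z * F (g z)"
          "\<lambda>z. poly Q (g z) * (deriv F z * poly Q z + F z * poly (- pderiv Q - b * Q) z + poly (- c * Q\<^sup>2) z)"])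
      have Fg: "(\<lambda>z. F (g z)) holomorphic_on UNIV"
        using holomorphic_on_compose_gen[OF g F] by (simp add: o_def)
      have Qg: "(\<lambda>z. poly Q (g z)) holomorphic_on UNIV"
        using g by (intro holomorphic_intros)
      show "(\<lambda>z. poly (a * Q\<^sup>2) z * F (g z)) holomorphic_on UNIV"
        by (intro holomorphic_intros Fg)
      show "(\<lambda>z. poly Q (g z) * (deriv F z * poly Q z + F z * poly (- pderiv Q - b * Q) z + poly (- c * Q\<^sup>2) z)) holomorphic_on UNIV"
        by (intro holomorphic_intros Qg F) auto
      have "\<forall>\<^sub>F z in at z0. f analytic_on {g z}"
        using eventually_analytic[of "g z0"] filterlim_g[of z0] by (rule eventually_compose_filterlim)
      with eventually_analytic[of z0]
      show "\<forall>\<^sub>F z in at z0. poly (a * Q\<^sup>2) z * F (g z) = poly Q (g z) *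
          (deriv F z * poly Q z + F z * poly (- pderiv Q - b * Q) z + poly (- c * Q\<^sup>2) z)"
      proof eventually_elim
        case (elim z)
        show ?case
          unfolding F_val[OF elim(1)] F_val[OF elim(2)] F_deriv[OF elim(1)] eq[OF elim]
          by (simp add: power2_eq_square algebra_simps)
      qed
    qed
  qed
qed

section \<open>Reduction to lines through the origin\<close>

lemma cpoly_fun_on_line:
  assumes "cpoly_fun p"
  obtains q :: "complex poly" where "\<And>s. p (x + s *s v) = poly q s"
proof -
  from assms have "\<exists>q. \<forall>s. p (x + s *s v) = poly q s"
  proof induction
    case (const c)
    show ?case by (rule exI[of _ "[:c:]"]) simp
  next
    case (coord j)
    show ?case by (rule exI[of _ "[:x $ j, v $ j:]"]) simp
  next
    case (add p q)
    then obtain p' q' where "\<forall>s. p (x + s *s v) = poly p' s" "\<forall>s. q (x + s *s v) = poly q' s" by blast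
    thus ?case by (intro exI[of _ "p' + q'"]) simp
  next
    case (mult p q)
    then obtain p' q' where "\<forall>s. p (x + s *s v) = poly p' s" "\<forall>s. q (x + s *s v) = poly q' s" by blast
    thus ?case by (intro exI[of _ "p' * q'"]) simp
  qed
  thus thesis using that by blast
qed

lemma cpoly_fun_sum:
  assumes "finite A" "\<And>j. j \<in> A \<Longrightarrow> cpoly_fun (p j)"
  shows "cpoly_fun (\<lambda>z. \<Sum>j\<in>A. p j z)"
  using assms by (induction A rule: finite_induct) (auto intro: cpoly_fun.intros)

lemma eventually_poly_nonzero:
  fixes q :: "complex poly"
  assumes "q \<noteq> 0"
  shows "\<forall>\<^sub>F t in at t0. poly q t \<noteq> 0"
proof -
  have "{t. poly q t = 0} sparse_in UNIV" using poly_roots_finite[OF assms] by (rule finite_imp_sparse)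
  thus ?thesis unfolding sparse_in_eventually_iff[OF open_UNIV] by simp
qed

lemma has_derivative_scale_vector:
  fixes v :: "complex ^ 'n"
  shows "((\<lambda>s. s *s v) has_derivative (\<lambda>h. h *s v)) (at s0)"
proof -
  have "linear (\<lambda>s. s *s v)"
    by (rule linearI) (simp_all add: vec_eq_iff algebra_simps)
  hence "bounded_linear (\<lambda>s. s *s v)" by (simp add: linear_conv_bounded_linear)
  thus ?thesis by (rule bounded_linear_imp_has_derivative)
qed

lemma entire_n_on_line:
  fixes v :: "complex ^ 'n"
  assumes L: "(g has_derivative L) (at (s0 *s v))" "\<And>c v. L (c *s v) = c * L v"
  shows "((\<lambda>s. g (s *s v)) has_field_derivative L v) (at s0)"
proof -
  have "((\<lambda>s. g (s *s v)) has_derivative (\<lambda>h. L (h *s v))) (at s0)"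
    using has_derivative_scale_vector L(1) by (rule has_derivative_compose)
  also have "(\<lambda>h. L (h *s v)) = (\<lambda>h. L v * h)" by (simp add: L(2) mult.commute)
  finally show ?thesis by (simp add: has_field_derivative_def)
qed

theorem theorem1p2:
  fixes f :: "complex \<Rightarrow> complex"
    and g a b c :: "complex ^ 'n \<Rightarrow> complex"
    and i :: 'n
  assumes "transcendental_mero f"
    and "entire_n g"
    and "cpoly_fun a" and "\<exists>z. a z \<noteq> 0"
    and "cpoly_fun b" and "cpoly_fun c"
    and "\<And>z. f analytic_on {\<Sum>j\<in>UNIV. z $ j} \<Longrightarrow>
              f analytic_on {of_nat CARD('n) * g z} \<Longrightarrow>
           deriv (\<lambda>t. f (\<Sum>j\<in>UNIV. (\<chi> k. if k = i then t else z $ k) $ j)) (z $ i)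
             = a z * f (\<Sum>j\<in>UNIV. ((\<chi> k. g z) :: complex ^ 'n) $ j) + b z * f (\<Sum>j\<in>UNIV. z $ j) + c z"
  shows "linear_n g"
proof -
  define \<sigma> where "\<sigma> = (\<lambda>z :: complex ^ 'n. \<Sum>j\<in>UNIV. z $ j)"
  have \<sigma>_add: "\<sigma> (x + y) = \<sigma> x + \<sigma> y" and \<sigma>_scale: "\<sigma> (s *s x) = s * \<sigma> x" for x y s
    by (simp_all add: \<sigma>_def sum.distrib sum_distrib_left)
  have f: "f meromorphic_on UNIV" "\<not> rational_mero f"
    using assms(1) by (auto simp: transcendental_mero_def)
  obtain L where L: "(g has_derivative L) (at 0)" "\<And>c v. L (c *s v) = c * L v"
    using assms(2) unfolding entire_n_def by blast
  have g_lines: "(\<lambda>s. g (s *s v)) holomorphic_on UNIV" for v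
    unfolding holomorphic_on_def field_differentiable_def
    using assms(2) entire_n_on_line[of g _ _ v] by (metis entire_n_def has_field_derivative_at_within)
  \<comment> \<open>The sum of the modified coordinates is t plus a constant, so the partial
    derivative is f' at the coordinate sum, whatever \<open>i\<close> is.\<close>
  have partial: "deriv (\<lambda>t. f (\<Sum>j\<in>UNIV. (\<chi> k. if k = i then t else z $ k) $ j)) (z $ i) = deriv f (\<sigma> z)"
    if "f analytic_on {\<sigma> z}" for z :: "complex ^ 'n"
  proof -
    have "(\<Sum>j\<in>UNIV. (\<chi> k. if k = i then t else z $ k) $ j) = t + (\<sigma> z - z $ i)" for t
      unfolding \<sigma>_def by (simp add: sum.If_cases Compl_eq_Diff_UNIV sum.remove[of UNIV i "\<lambda>j. z $ j"])
    moreover have "((\<lambda>t. f (t + (\<sigma> z - z $ i))) has_field_derivative deriv f (\<sigma> z) * 1) (at (z $ i))"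
    proof (rule DERIV_chain2[where f = f])
      show "(f has_field_derivative deriv f (\<sigma> z)) (at (z $ i + (\<sigma> z - z $ i)))"
        using analytic_on_imp_differentiable_at[OF that] DERIV_deriv_iff_field_differentiable by auto
    qed (auto intro!: derivative_eq_intros)
    ultimately show ?thesis by (simp add: DERIV_imp_deriv)
  qed
  have equation: "deriv f (\<sigma> z) = a z * f (of_nat CARD('n) * g z) + b z * f (\<sigma> z) + c z"
    if "f analytic_on {\<sigma> z}" "f analytic_on {of_nat CARD('n) * g z}" for z
    using assms(7)[of z] partial[of z] that by (simp add: \<sigma>_def)
  \<comment> \<open>The first condition permits rescaling so that the line parameter is the
    coordinate sum; the second keeps the restriction of \<open>a\<close> to the line
    nonzero.\<close>
  have generic: "g y = g 0 + L y" if y: "\<sigma> y \<noteq> 0" "a y \<noteq> 0" for y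
  proof -
    define v where "v = (1 / \<sigma> y) *s y"
    have y_eq: "y = \<sigma> y *s v" using y by (simp add: v_def)
    have \<sigma>v: "\<sigma> v = 1" using y by (simp add: v_def \<sigma>_scale)
    obtain pa where pa: "\<And>s. a (s *s v) = poly pa s"
      using cpoly_fun_on_line[OF assms(3), of 0 v] by (metis add_0)
    obtain pb where pb: "\<And>s. b (s *s v) = poly pb s"
      using cpoly_fun_on_line[OF assms(5), of 0 v] by (metis add_0)
    obtain pc where pc: "\<And>s. c (s *s v) = poly pc s"
      using cpoly_fun_on_line[OF assms(6), of 0 v] by (metis add_0)
    have "poly pa (\<sigma> y) \<noteq> 0" using y(2) pa[of "\<sigma> y"] y_eq by simp
    hence "pa \<noteq> 0" by auto
    define G where "G = (\<lambda>s. of_nat CARD('n) * g (s *s v))"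
    have "\<exists>\<alpha> \<beta>. \<forall>s. G s = \<alpha> + \<beta> * s"
    proof (rule entire_affine_if_equation[OF f _ \<open>pa \<noteq> 0\<close>])
      show "G holomorphic_on UNIV" unfolding G_def by (intro holomorphic_intros g_lines)
      fix s assume s: "f analytic_on {s}" "f analytic_on {G s}"
      have "\<sigma> (s *s v) = s" by (simp add: \<sigma>_scale \<sigma>v)
      thus "deriv f s = poly pa s * f (G s) + poly pb s * f s + poly pc s"
        using equation[of "s *s v"] s by (simp add: G_def pa pb pc)
    qed
    then obtain \<alpha> \<beta> where G: "\<And>s. G s = \<alpha> + \<beta> * s" by blast
    \<comment> \<open>Differentiation at 0 identifies the slope on each line with the same
      complex-linear map \<open>L\<close>, which glues the lines together.\<close>
    have "(G has_field_derivative of_nat CARD('n) * L v) (at 0)"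
      unfolding G_def using entire_n_on_line[of g L 0 v] L by (intro DERIV_cmult) simp
    moreover have "(G has_field_derivative \<beta>) (at 0)"
      unfolding G by (auto intro!: derivative_eq_intros)
    ultimately have "\<beta> = of_nat CARD('n) * L v" by (metis DERIV_unique)
    moreover have "\<alpha> = of_nat CARD('n) * g 0" using G[of 0] by (simp add: G_def)
    ultimately have "of_nat CARD('n) * g y = of_nat CARD('n) * (g 0 + \<sigma> y * L v)"
      using G[of "\<sigma> y"] y_eq by (simp add: G_def algebra_simps)
    hence "g y = g 0 + \<sigma> y * L v" by simp
    also have "\<sigma> y * L v = L y" using L(2)[of "\<sigma> y" v] y_eq by simp
    finally show ?thesis .
  qed
  obtain y0 where y0: "\<sigma> y0 \<noteq> 0" "a y0 \<noteq> 0"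
  proof -
    obtain z where z: "a z \<noteq> 0" using assms(4) by blast
    show thesis
    proof (cases "\<sigma> z = 0")
      case True
      \<comment> \<open>A small step along one axis makes the coordinate sum nonzero while
        \<open>a\<close> stays nonzero.\<close>
      obtain q where q: "\<And>t. a (z + t *s axis i 1) = poly q t" using cpoly_fun_on_line[OF assms(3)] by metis
      have "poly q 0 \<noteq> 0" using z q[of 0] by simp
      hence "\<forall>\<^sub>F t in at 0. poly q t \<noteq> 0" by (intro eventually_poly_nonzero) auto
      moreover have "\<forall>\<^sub>F t :: complex in at 0. t \<noteq> 0" by (simp add: eventually_at_filter)
      ultimately have "\<forall>\<^sub>F t in at 0. poly q t \<noteq> 0 \<and> t \<noteq> 0" by (rule eventually_conj)
      then obtain t where t: "poly q t \<noteq> 0" "t \<noteq> 0" using eventually_happens[of _ "at (0::complex)"] by auto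
      have "\<sigma> (axis i 1 :: complex ^ 'n) = 1" by (simp add: \<sigma>_def axis_def)
      hence "\<sigma> (z + t *s axis i 1) = t" by (simp add: \<sigma>_add \<sigma>_scale True)
      thus thesis using that[of "z + t *s axis i 1"] t q[of t] by simp
    qed (use z that in blast)
  qed
  have all: "g y = g 0 + L y" for y
  proof -
    \<comment> \<open>Along the segment from \<open>y\<close> to \<open>y0\<close> the polynomial a
      \<open>\<sigma>\<close> is nonzero at t = 1, hence at all t near 0 except possibly 0 itself,
      and the generic formula passes to the limit.\<close>
    define u where "u = y0 - y"
    define \<gamma> where "\<gamma> = (\<lambda>t. y + t *s u)"
    have "cpoly_fun (\<lambda>z. a z * \<sigma> z)"
      unfolding \<sigma>_def by (intro cpoly_fun.mult assms(3) cpoly_fun_sum cpoly_fun.coord) auto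
    then obtain q where q: "\<And>t. a (\<gamma> t) * \<sigma> (\<gamma> t) = poly q t"
      unfolding \<gamma>_def using cpoly_fun_on_line[of "\<lambda>z. a z * \<sigma> z" y u] by blast
    have "poly q 1 = a y0 * \<sigma> y0" using q[of 1] by (simp add: \<gamma>_def u_def)
    hence "poly q 1 \<noteq> 0" using y0 by simp
    hence "\<forall>\<^sub>F t in at 0. poly q t \<noteq> 0" by (intro eventually_poly_nonzero) auto
    hence ev: "\<forall>\<^sub>F t in at 0. g (\<gamma> t) - L (\<gamma> t) = g 0"
    proof eventually_elim
      case (elim t)
      hence "a (\<gamma> t) \<noteq> 0" "\<sigma> (\<gamma> t) \<noteq> 0" using q[of t] by auto
      from generic[OF this(2,1)] show ?case by simp
    qed
    have \<gamma>: "isCont \<gamma> 0" unfolding \<gamma>_def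
      using has_derivative_continuous[OF has_derivative_scale_vector[of u 0]] by (intro continuous_intros)
    have "isCont g (\<gamma> 0)"
      using assms(2) has_derivative_continuous unfolding entire_n_def by blast
    moreover have "isCont L (\<gamma> 0)"
      using L(1) has_derivative_bounded_linear linear_continuous_at by blast
    ultimately have "isCont (\<lambda>t. g (\<gamma> t) - L (\<gamma> t)) 0"
      using isCont_o2[OF \<gamma>] by (intro continuous_diff) auto
    hence "((\<lambda>t. g (\<gamma> t) - L (\<gamma> t)) \<longlongrightarrow> g y - L y) (at 0)"
      by (simp add: isCont_def \<gamma>_def)
    moreover have "((\<lambda>t. g (\<gamma> t) - L (\<gamma> t)) \<longlongrightarrow> g 0) (at 0)"
      using ev by (rule tendsto_eventually)
    ultimately have "g y - L y = g 0" by (intro tendsto_unique[of "at 0"]) auto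
    thus ?thesis by (simp add: algebra_simps)
  qed
  have "linear L" using L(1) has_derivative_linear by blast
  have L_sum: "L z = (\<Sum>j\<in>UNIV. L (axis j 1) * z $ j)" for z
  proof -
    have "L z = L (\<Sum>j\<in>UNIV. z $ j *s axis j 1)" by (simp add: basis_expansion)
    also have "\<dots> = (\<Sum>j\<in>UNIV. L (axis j 1) * z $ j)"
      by (simp add: linear_sum[OF \<open>linear L\<close>] L(2) mult.commute)
    finally show ?thesis .
  qed
  show ?thesis
    unfolding linear_n_def
  proof (intro exI allI)
    show "g z = g 0 + (\<Sum>j\<in>UNIV. L (axis j 1) * z $ j)" for z
      unfolding L_sum[symmetric] by (rule all)
  qed
qed

end
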